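(* Let $M$ be the monoid presented by $\langle a,b,c\mid ac=ca,\ bc=cb,\ cab=cbb\rangle$. Then: (1) every element of $M$ is represented by exactly one word in the set $\{a,b\}^*\cup c^+b^*a^*$; (2) $M$ is biautomatic and hence automatic; (3) $M$ does not have finite derivation type, and hence is not FCRS.
   Context: A monoid is FCRS if it admits a presentation by a finite complete (noetherian and confluent) string rewriting system over some finite generating set. FDT (finite derivation type, Squier): some (equivalently any) finite presentation has a derivation graph with a finite homotopy base (derivation graph: vertices are words, edges are single applications $x\ell y\leftrightarrow xry$ of defining relations; homotopy relation generated by a set of pairs of parallel paths is the smallest equivalence on paths contained in parallelism, closed under two-sided multiplication by words and under composition on either side, identifying $\mathbb{P}\circ\mathbb{P}^{-1}$ with the empty path and identifying the two orders of applying two disjoint rewrites; a homotopy base is a set generating all of parallelism). Automatic/biautomatic: for a finite generating alphabet $A$ and regular $L\subseteq A^*$ mapping onto $M$, with $L_a=\{(u,v)\in L^2: ua=_Mv\}$, ${}_aL=\{(u,v)\in L^2: au=_Mv\}$, and $\delta_R$ ($\delta_L$) padding the shorter word at the end (beginning) with $\$$: automatic if all $L_a\delta_R$ regular; biautomatic if all $L_a\delta_R,{}_aL\delta_R,L_a\delta_L,{}_aL\delta_L$ regular, for some such $(A,L)$. *)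

theory Defs
  imports "HOL-Algebra.Group"
begin

definition rstep :: "('a list \<times> 'a list) set \<Rightarrow> 'a list \<Rightarrow> 'a list \<Rightarrow> bool" where
  "rstep R u v \<longleftrightarrow> (\<exists>x y l r. (l, r) \<in> R \<and> u = x @ l @ y \<and> v = x @ r @ y)"

definition pcong :: "'a set \<Rightarrow> ('a list \<times> 'a list) set \<Rightarrow> 'a list \<Rightarrow> 'a list \<Rightarrow> bool" where
  "pcong A R u v \<longleftrightarrow> u \<in> lists A \<and> v \<in> lists A \<and>
     (\<lambda>s t. rstep R s t \<or> rstep R t s)\<^sup>*\<^sup>* u v"

definition pclass :: "'a set \<Rightarrow> ('a list \<times> 'a list) set \<Rightarrow> 'a list \<Rightarrow> 'a list set" where
  "pclass A R u = {v. pcong A R u v}"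

definition pres_monoid :: "'a set \<Rightarrow> ('a list \<times> 'a list) set \<Rightarrow> 'a list set monoid" where
  "pres_monoid A R = \<lparr> carrier = pclass A R ` lists A,
      mult = (\<lambda>X Y. {w. \<exists>x\<in>X. \<exists>y\<in>Y. pcong A R (x @ y) w}),
      one = pclass A R [] \<rparr>"

datatype gen = a | b | c

definition relsM :: "(gen list \<times> gen list) set" where
  "relsM = {([a, c], [c, a]), ([b, c], [c, b]), ([c, a, b], [c, b, b])}"

definition monM :: "gen list set monoid" where
  "monM = pres_monoid UNIV relsM"

definition NF :: "gen list set" where
  "NF = lists {a, b} \<union>
        {replicate (Suc i) c @ replicate j b @ replicate k a | i j k. True}"

definition regular :: "'s list set \<Rightarrow> bool" where
  "regular L \<longleftrightarrow> (\<exists>(Q :: nat set) q0 \<delta> F. finite Q \<and> q0 \<in> Q \<and> (\<forall>q\<in>Q. \<forall>x. \<delta> q x \<in> Q) \<and>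
       F \<subseteq> Q \<and> L = {w. foldl \<delta> q0 w \<in> F})"

definition padR :: "'s list \<Rightarrow> 's list \<Rightarrow> ('s option \<times> 's option) list" where
  "padR u v = (let n = max (length u) (length v) in
     zip (map Some u @ replicate (n - length u) None) (map Some v @ replicate (n - length v) None))"

definition padL :: "'s list \<Rightarrow> 's list \<Rightarrow> ('s option \<times> 's option) list" where
  "padL u v = (let n = max (length u) (length v) in
     zip (replicate (n - length u) None @ map Some u) (replicate (n - length v) None @ map Some v))"

definition deltaR :: "('s list \<times> 's list) set \<Rightarrow> ('s option \<times> 's option) list set" where
  "deltaR P = (\<lambda>(u, v). padR u v) ` P"

definition deltaL :: "('s list \<times> 's list) set \<Rightarrow> ('s option \<times> 's option) list set" where
  "deltaL P = (\<lambda>(u, v). padL u v) ` P"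

definition evalw :: "('m, 'z) monoid_scheme \<Rightarrow> ('s \<Rightarrow> 'm) \<Rightarrow> 's list \<Rightarrow> 'm" where
  "evalw G g w = foldr (\<lambda>x acc. g x \<otimes>\<^bsub>G\<^esub> acc) w \<one>\<^bsub>G\<^esub>"

definition Lright :: "('m, 'z) monoid_scheme \<Rightarrow> ('s \<Rightarrow> 'm) \<Rightarrow> 's list set \<Rightarrow> 's \<Rightarrow> ('s list \<times> 's list) set" where
  "Lright G g L x = {(u, v). u \<in> L \<and> v \<in> L \<and> evalw G g u \<otimes>\<^bsub>G\<^esub> g x = evalw G g v}"

definition Lleft :: "('m, 'z) monoid_scheme \<Rightarrow> ('s \<Rightarrow> 'm) \<Rightarrow> 's list set \<Rightarrow> 's \<Rightarrow> ('s list \<times> 's list) set" where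
  "Lleft G g L x = {(u, v). u \<in> L \<and> v \<in> L \<and> g x \<otimes>\<^bsub>G\<^esub> evalw G g u = evalw G g v}"

definition auto_structure :: "('m, 'z) monoid_scheme \<Rightarrow> nat set \<Rightarrow> (nat \<Rightarrow> 'm) \<Rightarrow> nat list set \<Rightarrow> bool" where
  "auto_structure G A g L \<longleftrightarrow> finite A \<and> g ` A \<subseteq> carrier G \<and> L \<subseteq> lists A \<and> regular L \<and>
      evalw G g ` L = carrier G"

definition automatic :: "('m, 'z) monoid_scheme \<Rightarrow> bool" where
  "automatic G \<longleftrightarrow> (\<exists>A g L. auto_structure G A g L \<and>
      (\<forall>x\<in>A. regular (deltaR (Lright G g L x))))"

definition biautomatic :: "('m, 'z) monoid_scheme \<Rightarrow> bool" where
  "biautomatic G \<longleftrightarrow> (\<exists>A g L. auto_structure G A g L \<and>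
      (\<forall>x\<in>A. regular (deltaR (Lright G g L x)) \<and> regular (deltaR (Lleft G g L x)) \<and>
              regular (deltaL (Lright G g L x)) \<and> regular (deltaL (Lleft G g L x))))"

definition rew :: "'a set \<Rightarrow> ('a list \<times> 'a list) set \<Rightarrow> 'a list \<Rightarrow> 'a list \<Rightarrow> bool" where
  "rew A R u v \<longleftrightarrow> u \<in> lists A \<and> rstep R u v"

definition complete_rs :: "'a set \<Rightarrow> ('a list \<times> 'a list) set \<Rightarrow> bool" where
  "complete_rs A R \<longleftrightarrow> wf {(v, u). rew A R u v} \<and>
     (\<forall>u v w. (rew A R)\<^sup>*\<^sup>* u v \<longrightarrow> (rew A R)\<^sup>*\<^sup>* u w \<longrightarrow>
        (\<exists>z. (rew A R)\<^sup>*\<^sup>* v z \<and> (rew A R)\<^sup>*\<^sup>* w z))"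

definition FCRS :: "('m, 'z) monoid_scheme \<Rightarrow> bool" where
  "FCRS G \<longleftrightarrow> (\<exists>(A :: nat set) R. finite A \<and> finite R \<and> R \<subseteq> lists A \<times> lists A \<and>
      complete_rs A R \<and> pres_monoid A R \<cong> G)"

text \<open>An edge (x,l,r,y) goes from x l y to x r y, where (l,r) or (r,l) is a defining relation.\<close>
type_synonym 'a edge = "'a list \<times> 'a list \<times> 'a list \<times> 'a list"
text \<open>A path (w, es, w') from w to w' along the edges es.\<close>
type_synonym 'a dpath = "'a list \<times> 'a edge list \<times> 'a list"

definition edge_ok :: "'a set \<Rightarrow> ('a list \<times> 'a list) set \<Rightarrow> 'a edge \<Rightarrow> bool" where
  "edge_ok A R e = (case e of (x, l, r, y) \<Rightarrow>
      x \<in> lists A \<and> y \<in> lists A \<and> ((l, r) \<in> R \<or> (r, l) \<in> R))"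

fun esrc :: "'a edge \<Rightarrow> 'a list" where "esrc (x, l, r, y) = x @ l @ y"
fun etgt :: "'a edge \<Rightarrow> 'a list" where "etgt (x, l, r, y) = x @ r @ y"
fun einv :: "'a edge \<Rightarrow> 'a edge" where "einv (x, l, r, y) = (x, r, l, y)"
fun ewhisk :: "'a list \<Rightarrow> 'a list \<Rightarrow> 'a edge \<Rightarrow> 'a edge" where
  "ewhisk u v (x, l, r, y) = (u @ x, l, r, y @ v)"

fun is_path :: "'a set \<Rightarrow> ('a list \<times> 'a list) set \<Rightarrow> 'a list \<Rightarrow> 'a edge list \<Rightarrow> 'a list \<Rightarrow> bool" where
  "is_path A R w [] w' \<longleftrightarrow> w \<in> lists A \<and> w' = w"
| "is_path A R w (e # es) w' \<longleftrightarrow> edge_ok A R e \<and> esrc e = w \<and> is_path A R (etgt e) es w'"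

fun valid_path :: "'a set \<Rightarrow> ('a list \<times> 'a list) set \<Rightarrow> 'a dpath \<Rightarrow> bool" where
  "valid_path A R (w, es, w') = is_path A R w es w'"

fun psrc :: "'a dpath \<Rightarrow> 'a list" where "psrc (w, es, w') = w"
fun ptgt :: "'a dpath \<Rightarrow> 'a list" where "ptgt (w, es, w') = w'"

fun pcomp :: "'a dpath \<Rightarrow> 'a dpath \<Rightarrow> 'a dpath" where
  "pcomp (w, es, _) (_, fs, w') = (w, es @ fs, w')"
fun pinv :: "'a dpath \<Rightarrow> 'a dpath" where
  "pinv (w, es, w') = (w', rev (map einv es), w)"
fun pwhisk :: "'a list \<Rightarrow> 'a list \<Rightarrow> 'a dpath \<Rightarrow> 'a dpath" where
  "pwhisk u v (w, es, w') = (u @ w @ v, map (ewhisk u v) es, u @ w' @ v)"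
definition epath :: "'a edge \<Rightarrow> 'a dpath" where
  "epath e = (esrc e, [e], etgt e)"

definition parallel :: "'a set \<Rightarrow> ('a list \<times> 'a list) set \<Rightarrow> 'a dpath \<Rightarrow> 'a dpath \<Rightarrow> bool" where
  "parallel A R p q \<longleftrightarrow> valid_path A R p \<and> valid_path A R q \<and> psrc p = psrc q \<and> ptgt p = ptgt q"

inductive_set homotopy :: "'a set \<Rightarrow> ('a list \<times> 'a list) set \<Rightarrow> ('a dpath \<times> 'a dpath) set
    \<Rightarrow> ('a dpath \<times> 'a dpath) set"
  for A R X where
  h_base: "(p, q) \<in> X \<Longrightarrow> parallel A R p q \<Longrightarrow> (p, q) \<in> homotopy A R X"
| h_refl: "valid_path A R p \<Longrightarrow> (p, p) \<in> homotopy A R X"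
| h_sym: "(p, q) \<in> homotopy A R X \<Longrightarrow> (q, p) \<in> homotopy A R X"
| h_trans: "(p, q) \<in> homotopy A R X \<Longrightarrow> (q, s) \<in> homotopy A R X \<Longrightarrow> (p, s) \<in> homotopy A R X"
| h_whisk: "(p, q) \<in> homotopy A R X \<Longrightarrow> u \<in> lists A \<Longrightarrow> v \<in> lists A \<Longrightarrow>
      (pwhisk u v p, pwhisk u v q) \<in> homotopy A R X"
| h_compL: "(p, q) \<in> homotopy A R X \<Longrightarrow> valid_path A R r \<Longrightarrow> ptgt r = psrc p \<Longrightarrow>
      (pcomp r p, pcomp r q) \<in> homotopy A R X"
| h_compR: "(p, q) \<in> homotopy A R X \<Longrightarrow> valid_path A R r \<Longrightarrow> psrc r = ptgt p \<Longrightarrow>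
      (pcomp p r, pcomp q r) \<in> homotopy A R X"
| h_inv: "valid_path A R p \<Longrightarrow> (pcomp p (pinv p), (psrc p, [], psrc p)) \<in> homotopy A R X"
| h_indep: "edge_ok A R e1 \<Longrightarrow> edge_ok A R e2 \<Longrightarrow>
      (pcomp (epath (ewhisk [] (esrc e2) e1)) (epath (ewhisk (etgt e1) [] e2)),
       pcomp (epath (ewhisk (esrc e1) [] e2)) (epath (ewhisk [] (etgt e2) e1))) \<in> homotopy A R X"

definition homotopy_base :: "'a set \<Rightarrow> ('a list \<times> 'a list) set \<Rightarrow> ('a dpath \<times> 'a dpath) set \<Rightarrow> bool" where
  "homotopy_base A R X \<longleftrightarrow> X \<subseteq> {(p, q). parallel A R p q} \<and>
     homotopy A R X = {(p, q). parallel A R p q}"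

definition FDT :: "('m, 'z) monoid_scheme \<Rightarrow> bool" where
  "FDT G \<longleftrightarrow> (\<exists>(A :: nat set) R. finite A \<and> finite R \<and> R \<subseteq> lists A \<times> lists A \<and>
      pres_monoid A R \<cong> G \<and> (\<exists>X. finite X \<and> homotopy_base A R X))"

end

theory Submission
  imports Defs
begin

text \<open>Since \<open>c\<close> is central and \<open>cab = cbb\<close>, a word with at least one \<open>c\<close> is determined by the number
  of letters \<open>c\<close>, by the length of the remaining word, and by the number of letters \<open>a\<close> at its end;
  no relation applies to a word without \<open>c\<close>. This gives the normal forms, and multiplying a normal
  form by a letter changes it only locally, which yields biautomaticity.

  For the negative part consider words with exactly one \<open>c\<close>. Deleting \<open>c\<close>, an edge of the derivation
  graph flips at most one letter. Let \<open>p\<close> indicate that the word starts with \<open>a\<close> and \<open>q\<close> that it ends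
  with \<open>ab\<close>, and integrate the form \<open>q dp\<close> along paths. In a long word a circuit inside a bounded window
  keeps \<open>p\<close> or \<open>q\<close> constant, hence has integral 0, and a pair of disjoint rewrites contributes nothing
  since only one of the two can involve \<open>c\<close>. So a finite homotopy base would make the integral
  independent of the path, but the square obtained from \<open>acb z ab\<close> by changing \<open>acb\<close> into \<open>bcb\<close> and
  the final \<open>ab\<close> into \<open>bb\<close>, in either order, has integral \<open>-1\<close> on one side and 0 on the other. The argument
  works over any finite presentation, because \<open>p\<close> and \<open>q\<close> can be pulled back along a choice of
  representatives for the generators. Finite complete systems are excluded by the same form, as
  their critical pairs live in bounded windows.\<close>

section \<open>Presentations\<close>

lemma rstep_context: "rstep R s t \<Longrightarrow> rstep R (x @ s @ y) (x @ t @ y)"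
  unfolding rstep_def by (metis append.assoc)

locale presentation =
  fixes A :: "'s set" and R :: "('s list \<times> 's list) set"
  assumes rels: "R \<subseteq> lists A \<times> lists A"
begin

abbreviation sstep :: "'s list \<Rightarrow> 's list \<Rightarrow> bool" where
  "sstep s t \<equiv> rstep R s t \<or> rstep R t s"

lemma pcong_refl: "u \<in> lists A \<Longrightarrow> pcong A R u u"
  by (simp add: pcong_def)

lemma pcong_sym: "pcong A R u v \<Longrightarrow> pcong A R v u"
  unfolding pcong_def
  by (metis (mono_tags, lifting) rtranclp_converseI rtranclp_mono predicate2I conversep_iff
      symp_def symp_rtranclp)

lemma pcong_trans [trans]: "pcong A R u v \<Longrightarrow> pcong A R v w \<Longrightarrow> pcong A R u w"
  unfolding pcong_def by (auto intro: rtranclp_trans)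

lemma sstep_in_lists: "sstep s t \<Longrightarrow> s \<in> lists A \<Longrightarrow> t \<in> lists A"
  using rels by (fastforce simp: rstep_def)

lemma pcong_sstep: "sstep s t \<Longrightarrow> s \<in> lists A \<Longrightarrow> pcong A R s t"
  using sstep_in_lists by (auto simp: pcong_def)

lemma pcong_rel: "(l, r) \<in> R \<Longrightarrow> pcong A R l r"
proof -
  assume lr: "(l, r) \<in> R"
  then have "rstep R l r" unfolding rstep_def by (metis append_Nil append_Nil2)
  with lr rels show ?thesis by (intro pcong_sstep) auto
qed

lemma pcong_context:
  assumes "pcong A R s t" "x \<in> lists A" "y \<in> lists A"
  shows "pcong A R (x @ s @ y) (x @ t @ y)"
proof -
  have "sstep\<^sup>*\<^sup>* s t" using assms by (simp add: pcong_def)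
  then have "sstep\<^sup>*\<^sup>* (x @ s @ y) (x @ t @ y)"
    by (induction rule: rtranclp_induct) (auto intro: rtranclp.rtrancl_into_rtrancl rstep_context)
  with assms show ?thesis by (simp add: pcong_def)
qed

lemma pcong_append:
  assumes "pcong A R s t" "pcong A R s' t'"
  shows "pcong A R (s @ s') (t @ t')"
proof -
  have "pcong A R ([] @ s @ s') ([] @ t @ s')"
    using assms by (intro pcong_context) (auto simp: pcong_def)
  moreover have "pcong A R (t @ s' @ []) (t @ t' @ [])"
    using assms by (intro pcong_context) (auto simp: pcong_def)
  ultimately show ?thesis using pcong_trans by simp
qed

lemma pcong_prepend: "pcong A R s t \<Longrightarrow> x \<in> lists A \<Longrightarrow> pcong A R (x @ s) (x @ t)"
  by (simp add: pcong_append pcong_refl)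

lemma pcong_postpend: "pcong A R s t \<Longrightarrow> x \<in> lists A \<Longrightarrow> pcong A R (s @ x) (t @ x)"
  by (simp add: pcong_append pcong_refl)

lemma pclass_eq_iff: "u \<in> lists A \<Longrightarrow> pclass A R u = pclass A R v \<longleftrightarrow> pcong A R u v"
  unfolding pclass_def using pcong_refl pcong_sym pcong_trans by blast

lemma pclass_mult:
  assumes "u \<in> lists A" "v \<in> lists A"
  shows "pclass A R u \<otimes>\<^bsub>pres_monoid A R\<^esub> pclass A R v = pclass A R (u @ v)"
proof -
  have "pcong A R (u @ v) w \<longleftrightarrow> (\<exists>x y. pcong A R u x \<and> pcong A R v y \<and> pcong A R (x @ y) w)" for w
    using assms pcong_append pcong_refl pcong_sym pcong_trans by meson
  then show ?thesis by (auto simp: pclass_def pres_monoid_def)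
qed

lemma carrier_pres_monoid: "carrier (pres_monoid A R) = pclass A R ` lists A"
  and one_pres_monoid: "\<one>\<^bsub>pres_monoid A R\<^esub> = pclass A R []"
  by (simp_all add: pres_monoid_def)

lemma pclass_in_carrier: "u \<in> lists A \<Longrightarrow> pclass A R u \<in> carrier (pres_monoid A R)"
  by (simp add: carrier_pres_monoid)

lemma evalw_pclass:
  assumes "w \<in> lists B" "\<And>x. x \<in> B \<Longrightarrow> f x \<in> lists A"
  shows "evalw (pres_monoid A R) (\<lambda>x. pclass A R (f x)) w = pclass A R (concat (map f w))"
proof -
  have "evalw (pres_monoid A R) (\<lambda>x. pclass A R (f x)) w = pclass A R (concat (map f w)) \<and>
      concat (map f w) \<in> lists A"
    using assms(1)
    by (induction w) (auto simp: evalw_def one_pres_monoid pclass_mult assms(2))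
  then show ?thesis ..
qed

end

section \<open>Normal forms\<close>

interpretation M: presentation UNIV relsM
  by unfold_locales simp

abbreviation eqM :: "gen list \<Rightarrow> gen list \<Rightarrow> bool" (infix "\<approx>" 50) where
  "u \<approx> v \<equiv> pcong UNIV relsM u v"

definition strip :: "gen list \<Rightarrow> gen list" where
  "strip w = filter (\<lambda>x. x \<noteq> c) w"

abbreviation cdeg :: "gen list \<Rightarrow> nat" where
  "cdeg w \<equiv> count_list w c"

definition atail :: "gen list \<Rightarrow> nat" where
  "atail w = length (takeWhile (\<lambda>x. x = a) (rev w))"

text \<open>A letter c can be brought in front of any factor ab, so next to a c every letter a that
  has a b somewhere to its right turns into b. Only the final block of letters a survives.\<close>

definition nf :: "gen list \<Rightarrow> gen list" where
  "nf w = (if cdeg w = 0 then w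
     else replicate (cdeg w) c @ replicate (length (strip w) - atail (strip w)) b @
       replicate (atail (strip w)) a)"

lemma strip_simps [simp]:
  "strip [] = []" "strip (x # w) = (if x = c then strip w else x # strip w)"
  "strip (u @ v) = strip u @ strip v"
  by (auto simp: strip_def)

lemma strip_id_iff: "strip w = w \<longleftrightarrow> cdeg w = 0"
  by (induction w) (auto simp: strip_def, metis impossible_Cons length_filter_le)

lemma cdeg_0_iff: "cdeg w = 0 \<longleftrightarrow> w \<in> lists {a, b}"
  by (induction w) (auto, metis gen.exhaust)

lemma cdeg_strip [simp]: "cdeg (strip w) = 0"
  by (induction w) auto

lemma length_cdeg_strip: "length w = cdeg w + length (strip w)"
  by (induction w) auto

lemma atail_simps [simp]:
  "atail [] = 0"
  "atail (w @ [x]) = (if x = a then Suc (atail w) else 0)"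
  by (auto simp: atail_def)

lemma atail_append:
  "atail (u @ v) = (if set v \<subseteq> {a} then length v + atail u else atail v)"
  by (induction v rule: rev_induct) (auto simp flip: append_assoc)

lemma atail_Cons: "atail (x # v) = (if set v \<subseteq> {a} \<and> x = a then Suc (length v)
    else if set v \<subseteq> {a} then length v else atail v)"
  using atail_append[of "[x]" v] atail_simps(2)[of "[]" x] by auto

lemma atail_replicate [simp]: "atail (replicate k a) = k"
  by (induction k) (auto simp flip: replicate_append_same)

lemma atail_le: "atail w \<le> length w"
  by (metis atail_def length_rev length_takeWhile_le)

lemma atail_eq_length: "atail w = length w \<longleftrightarrow> set w \<subseteq> {a}"
  by (induction w rule: rev_induct) auto

lemma atail_zero: "atail (replicate k b) = 0"
  by (induction k) (auto simp flip: replicate_append_same)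

lemma nf_ab: "cdeg w = 0 \<Longrightarrow> nf w = w"
  by (simp add: nf_def)

lemma nf_normal: "nf (replicate (Suc i) c @ replicate j b @ replicate k a) =
    replicate (Suc i) c @ replicate j b @ replicate k a"
proof -
  have s: "strip (replicate n c) = []" "strip (replicate n b) = replicate n b"
     "strip (replicate n a) = replicate n a" for n
    by (auto simp: strip_def)
  have c: "cdeg (replicate n c) = n" "cdeg (replicate n b) = 0" "cdeg (replicate n a) = 0" for n
    by (induction n) auto
  have "atail (replicate j b @ replicate k a) = k"
    by (simp add: atail_append atail_zero) 
  then show ?thesis by (simp add: nf_def s c)
qed

lemma nf_in_NF: "nf w \<in> NF"
proof (cases "cdeg w")
  case 0
  then show ?thesis using cdeg_0_iff by (auto simp: nf_def NF_def)
next
  case (Suc i)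
  then show ?thesis unfolding nf_def NF_def by fastforce
qed

lemma nf_fixes_NF: "w \<in> NF \<Longrightarrow> nf w = w"
  unfolding NF_def using nf_normal nf_ab cdeg_0_iff by (auto simp: in_lists_conv_set)

lemma rel_cases:
  assumes "(l, r) \<in> relsM"
  obtains "l = [a, c]" "r = [c, a]" | "l = [b, c]" "r = [c, b]" | "l = [c, a, b]" "r = [c, b, b]"
  using assms by (auto simp: relsM_def)

lemma rel_mem: "([a, c], [c, a]) \<in> relsM" "([b, c], [c, b]) \<in> relsM"
    "([c, a, b], [c, b, b]) \<in> relsM"
  by (auto simp: relsM_def)

text \<open>Both sides of each relation contain equally many letters c. After deletion of c they are
  equal or are ab and bb; these have the same length and end in b, so the final block of letters a
  in the whole word is the same.\<close>

lemma cong_invariants: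
  assumes "u \<approx> v"
  shows "cdeg u = cdeg v" "length (strip u) = length (strip v)" "nf u = nf v"
proof -
  have step: "cdeg u = cdeg v \<and> length (strip u) = length (strip v) \<and> nf u = nf v"
    if uv: "rstep relsM u v" for u v
  proof -
    obtain x y l r where lr: "(l, r) \<in> relsM" "u = x @ l @ y" "v = x @ r @ y"
      using uv by (auto simp: rstep_def)
    \<comment> \<open>Positivity of \<open>cdeg l\<close> puts both words into the second branch of
      \<open>nf\<close>.\<close>
    have "cdeg l = cdeg r \<and> cdeg l > 0 \<and> length (strip l) = length (strip r)"
      using lr(1) by (rule rel_cases) auto
    moreover have "atail (strip u) = atail (strip v)"
      using lr(1) by (rule rel_cases) (auto simp: lr(2,3) atail_append atail_Cons)
    ultimately show ?thesis unfolding nf_def using lr by simp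
  qed
  have "M.sstep\<^sup>*\<^sup>* u v" using assms by (simp add: pcong_def)
  then have "cdeg u = cdeg v \<and> length (strip u) = length (strip v) \<and> nf u = nf v"
    by (induction rule: rtranclp_induct) (metis step)+
  then show "cdeg u = cdeg v" "length (strip u) = length (strip v)" "nf u = nf v" by auto
qed

lemma central: "replicate k c @ w \<approx> w @ replicate k c"
proof -
  have gen: "[c, x] \<approx> [x, c]" for x
    by (cases x) (simp_all add: M.pcong_refl M.pcong_sym M.pcong_rel rel_mem)
  have one: "c # w \<approx> w @ [c]" for w
  proof (induction w)
    case (Cons x w)
    have "c # x # w \<approx> x # c # w" using M.pcong_postpend[OF gen[of x], of w] by simp
    also have "x # c # w \<approx> x # w @ [c]" using M.pcong_prepend[OF Cons, of "[x]"] by simp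
    finally show ?case by simp
  qed (simp add: M.pcong_refl)
  show ?thesis
  proof (induction k)
    case (Suc k)
    have "c # (replicate k c @ w) \<approx> c # (w @ replicate k c)"
      using M.pcong_prepend[OF Suc, of "[c]"] by simp
    also have "\<dots> \<approx> (w @ replicate k c) @ [c]" by (rule one)
    finally show ?case by (simp add: replicate_append_same)
  qed (simp add: M.pcong_refl)
qed

lemma cong_strip: "w \<approx> replicate (cdeg w) c @ strip w"
proof (induction w)
  case (Cons x w)
  have "x # w \<approx> [x] @ replicate (cdeg w) c @ strip w"
    using M.pcong_prepend[OF Cons, of "[x]"] by simp
  also have "[x] @ replicate (cdeg w) c @ strip w \<approx> replicate (cdeg w) c @ [x] @ strip w"
    using M.pcong_postpend[OF M.pcong_sym[OF central], of "strip w" "[x]" "cdeg w"] by simp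
  finally show ?case
    by (cases "x = c") (simp_all add: replicate_app_Cons_same)
qed (simp add: M.pcong_refl)

text \<open>Induction from the left. If the tail is a power of a, the new letter leaves the word
  sorted. Otherwise the sorted tail starts with b, and the last c of the block turns a new letter a
  into b by cab = cbb.\<close>

lemma cong_sorted:
  assumes "cdeg s = 0"
  shows "replicate (Suc i) c @ s \<approx>
    replicate (Suc i) c @ replicate (length s - atail s) b @ replicate (atail s) a"
  using assms
proof (induction s)
  case (Cons x s)
  let ?C = "replicate (Suc i) c" and ?k = "atail s"
  let ?t = "replicate (length s - atail s) b @ replicate (atail s) a"
  have x: "x = a \<or> x = b" using Cons.prems by (cases x) auto
  \<comment> \<open>The new letter makes way so that the induction hypothesis finds the block of c
    next to the tail, and then moves back.\<close>
  have "?C @ [x] @ s \<approx> [x] @ ?C @ s"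
    using M.pcong_postpend[OF central, of s "Suc i" "[x]"] by simp
  also have "[x] @ ?C @ s \<approx> [x] @ ?C @ ?t"
    by (rule M.pcong_prepend[OF Cons.IH]) (use Cons.prems x in auto)
  also have "[x] @ ?C @ ?t \<approx> ?C @ [x] @ ?t"
    using M.pcong_postpend[OF M.pcong_sym[OF central], of ?t "[x]" "Suc i"] by simp
  also have "?C @ [x] @ ?t \<approx> ?C @ replicate (length (x # s) - atail (x # s)) b @
      replicate (atail (x # s)) a"
  proof (cases "set s \<subseteq> {a}")
    case True
    then have k: "?k = length s" by (simp add: atail_eq_length)
    have "atail (x # s) = (if x = a then Suc (length s) else length s)"
      using atail_append[of "[x]" s] True atail_simps(2)[of "[]" x] by auto
    with x k show ?thesis by (auto simp: M.pcong_refl)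
  next
    case False
    then have at: "atail (x # s) = ?k" using atail_append[of "[x]" s] by simp
    have "length s - ?k \<noteq> 0"
      using False atail_eq_length[of s] atail_le[of s] by simp
    then obtain m where m: "length s - ?k = Suc m"
      using not0_implies_Suc by blast
    have ab: "[c] @ [a, b] \<approx> [c] @ [b, b]"
      by (simp add: M.pcong_rel rel_mem)
    have "?C @ [a, b] @ y \<approx> ?C @ [b, b] @ y" for y
      using M.pcong_context[OF ab, of "replicate i c" y]
      by (simp add: replicate_app_Cons_same)
    then have "?C @ [x] @ ?t \<approx> ?C @ [b] @ ?t"
      using x m by (auto simp: M.pcong_refl)
    moreover have "length (x # s) - atail (x # s) = Suc (length s - ?k)"
      unfolding at using atail_le[of s] by simp
    ultimately show ?thesis using at by simp
  qed
  finally show ?case by simp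
qed (simp add: M.pcong_refl)

lemma cong_nf: "w \<approx> nf w"
proof (cases "cdeg w")
  case 0
  then show ?thesis by (simp add: nf_ab M.pcong_refl)
next
  case (Suc i)
  then have "replicate (cdeg w) c @ strip w \<approx> nf w"
    using cong_sorted[of "strip w" i] by (simp add: nf_def)
  then show ?thesis by (rule M.pcong_trans[OF cong_strip])
qed

lemma cong_iff: "u \<approx> v \<longleftrightarrow> nf u = nf v"
  using cong_invariants(3) cong_nf M.pcong_sym M.pcong_trans by metis

lemma unique_normal_form:
  assumes "m \<in> carrier monM"
  shows "\<exists>!u. u \<in> NF \<and> pclass UNIV relsM u = m"
proof -
  obtain w where w: "m = pclass UNIV relsM w"
    using assms by (auto simp: monM_def M.carrier_pres_monoid)
  show ?thesis
  proof (rule ex1I)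
    show "nf w \<in> NF \<and> pclass UNIV relsM (nf w) = m"
      using w cong_nf M.pclass_eq_iff nf_in_NF M.pcong_sym by auto
  next
    fix u assume u: "u \<in> NF \<and> pclass UNIV relsM u = m"
    then have "u \<approx> w" using w M.pclass_eq_iff by auto
    with u show "u = nf w" using cong_iff nf_fixes_NF by metis
  qed
qed

section \<open>Regular languages\<close>

text \<open>Allows automata with states of any type: the finite state set is injected into the
  natural numbers, and the transitions are conjugated by the injection.\<close>

lemma regularI:
  fixes Q :: "'q set" and \<delta> :: "'q \<Rightarrow> 'x \<Rightarrow> 'q"
  assumes "finite Q" "q0 \<in> Q" "\<And>q x. q \<in> Q \<Longrightarrow> \<delta> q x \<in> Q"
    and L: "\<And>w. w \<in> L \<longleftrightarrow> foldl \<delta> q0 w \<in> F"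
  shows "regular L"
proof -
  obtain f :: "'q \<Rightarrow> nat" where f: "inj_on f Q"
    using finite_imp_inj_to_nat_seg[OF assms(1)] by auto
  define g where "g = the_inv_into Q f"
  have g: "g (f q) = q" if "q \<in> Q" for q
    using the_inv_into_f_f[OF f that] by (simp add: g_def)
  have run: "foldl \<delta> q w \<in> Q" if "q \<in> Q" for q w
    using that by (induction w arbitrary: q) (auto simp: assms(3))
  have fold: "foldl (\<lambda>n x. f (\<delta> (g n) x)) (f q) w = f (foldl \<delta> q w)" if "q \<in> Q" for q w
    using that by (induction w arbitrary: q) (auto simp: assms(3) g)
  have "L = {w. foldl (\<lambda>n x. f (\<delta> (g n) x)) (f q0) w \<in> f ` (F \<inter> Q)}"
    using inj_on_eq_iff[OF f] run[OF assms(2)] by (auto simp: L fold assms(2))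
  then show ?thesis
    unfolding regular_def using assms(1-3) g
    by (intro exI[of _ "f ` Q"] exI[of _ "f q0"] exI[of _ "\<lambda>n x. f (\<delta> (g n) x)"]
        exI[of _ "f ` (F \<inter> Q)"]) auto
qed

text \<open>Left quotient, also known as Brzozowski derivative.\<close>

definition quot :: "'x list set \<Rightarrow> 'x list \<Rightarrow> 'x list set" where
  "quot L w = {y. w @ y \<in> L}"

lemma quot_simps: "quot L [] = L" "quot L (u @ v) = quot (quot L u) v"
  "quot L (x # w) = quot (quot L [x]) w"
  by (auto simp: quot_def)

text \<open>Myhill-Nerode: a quotient depends only on the state reached, and conversely the
  quotients are the states of the minimal automaton. Closure properties then reduce to placing all
  quotients in a finite set.\<close>

lemma regular_iff_finite_quotients: "regular L \<longleftrightarrow> finite (range (quot L))"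
proof
  assume "regular L"
  then obtain Q q0 \<delta> F where Q: "finite (Q :: nat set)" "q0 \<in> Q" "\<forall>q\<in>Q. \<forall>x. \<delta> q x \<in> Q"
    and L: "L = {w. foldl \<delta> q0 w \<in> F}"
    unfolding regular_def by blast
  have "foldl \<delta> q0 w \<in> Q" for w
    using Q(2,3) by (induction w rule: rev_induct) auto
  then have "range (quot L) \<subseteq> (\<lambda>q. {y. foldl \<delta> q y \<in> F}) ` Q"
    by (auto simp: quot_def L)
  then show "finite (range (quot L))"
    using Q(1) finite_surj by blast
next
  assume fin: "finite (range (quot L))"
  have fold: "foldl (\<lambda>K x. quot K [x]) K w = quot K w" for K and w
    by (induction w arbitrary: K) (simp_all add: quot_simps(1) flip: quot_simps(3))
  show "regular L"
  proof (rule regularI[OF fin, of "quot L []"])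
    show "quot q [x] \<in> range (quot L)" if "q \<in> range (quot L)" for q x
      using that by (auto simp flip: quot_simps(2))
    show "w \<in> L \<longleftrightarrow> foldl (\<lambda>K x. quot K [x]) (quot L []) w \<in> {K. [] \<in> K}" for w
      unfolding fold by (simp add: quot_def)
  qed simp
qed

lemma regular_by_quotients: "finite \<Q> \<Longrightarrow> (\<And>w. quot L w \<in> \<Q>) \<Longrightarrow> regular L"
  unfolding regular_iff_finite_quotients by (meson finite_subset image_subsetI)

lemma regular_Un:
  assumes "regular K" "regular L"
  shows "regular (K \<union> L)"
proof (rule regular_by_quotients)
  show "finite ((\<lambda>(X, Y). X \<union> Y) ` (range (quot K) \<times> range (quot L)))"
    using assms by (simp add: regular_iff_finite_quotients)
  show "quot (K \<union> L) w \<in> (\<lambda>(X, Y). X \<union> Y) ` (range (quot K) \<times> range (quot L))" for w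
    by (rule image_eqI[of _ _ "(quot K w, quot L w)"]) (auto simp: quot_def)
qed

definition conc :: "'x list set \<Rightarrow> 'x list set \<Rightarrow> 'x list set" (infixr "\<cdot>" 75) where
  "K \<cdot> L = {u @ v | u v. u \<in> K \<and> v \<in> L}"

text \<open>For a word \<open>w @ y\<close> of the product, the cut lies either behind
  \<open>w\<close>, and \<open>y\<close> is in \<open>quot K w\<close> followed by \<open>L\<close>,
  or inside \<open>w\<close>, and \<open>y\<close> is in the quotient of \<open>L\<close> by the
  part of \<open>w\<close> after the cut. Only finitely many unions arise in this way.\<close>

lemma regular_conc:
  assumes "regular K" "regular L"
  shows "regular (K \<cdot> L)"
proof (rule regular_by_quotients)
  let ?Q = "(\<lambda>p. fst p \<cdot> L \<union> \<Union>(snd p)) ` (range (quot K) \<times> Pow (range (quot L)))"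
  show "finite ?Q"
    using assms by (simp add: regular_iff_finite_quotients)
  show "quot (K \<cdot> L) w \<in> ?Q" for w
  proof (rule image_eqI)
    let ?S = "{quot L v | u v. w = u @ v \<and> u \<in> K}"
    show "(quot K w, ?S) \<in> range (quot K) \<times> Pow (range (quot L))" by auto
    show "quot (K \<cdot> L) w = fst (quot K w, ?S) \<cdot> L \<union> \<Union>(snd (quot K w, ?S))"
    proof (intro Set.set_eqI iffI)
      fix y assume "y \<in> quot (K \<cdot> L) w"
      then obtain u v where uv: "w @ y = u @ v" "u \<in> K" "v \<in> L"
        by (auto simp: quot_def conc_def)
      then consider t where "w @ t = u" "y = t @ v" | t where "w = u @ t" "t @ y = v"
        by (auto simp: append_eq_append_conv2)
      then show "y \<in> fst (quot K w, ?S) \<cdot> L \<union> \<Union>(snd (quot K w, ?S))"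
        using uv by cases (auto simp: conc_def quot_def, blast)
    next
      fix y assume "y \<in> fst (quot K w, ?S) \<cdot> L \<union> \<Union>(snd (quot K w, ?S))"
      then obtain u v where "w @ y = u @ v" "u \<in> K" "v \<in> L"
        by (auto simp: conc_def quot_def; metis append.assoc)
      then show "y \<in> quot (K \<cdot> L) w"
        by (auto simp: conc_def quot_def)
    qed
  qed
qed

lemma regular_lists: "regular (lists S)"
  by (rule regular_by_quotients[of "{lists S, {}}"]) (auto simp: quot_def)

lemma regular_single: "regular {[x]}"
proof (rule regular_by_quotients)
  show "quot {[x]} w \<in> {{[x]}, {[]}, {}}" for w
    by (cases w) (auto simp: quot_def)
qed simp

lemma regular_eps: "regular {[]}"
  by (rule regular_by_quotients[of "{{[]}, {}}"]) (auto simp: quot_def)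

lemma regular_map:
  assumes "regular L" "inj f"
  shows "regular (map f ` L)"
proof (rule regular_by_quotients)
  let ?Q = "insert {} ((`) (map f) ` range (quot L))"
  show "finite ?Q" using assms(1) by (simp add: regular_iff_finite_quotients)
  show "quot (map f ` L) w \<in> ?Q" for w
  proof (cases "w \<in> range (map f)")
    case True
    then obtain w' where w: "w = map f w'" by blast
    have "map f w' @ y \<in> map f ` L \<longleftrightarrow> y \<in> map f ` quot L w'" for y
    proof
      assume "map f w' @ y \<in> map f ` L"
      then obtain z where z: "z \<in> L" "map f w' @ y = map f z" by blast
      then obtain z1 z2 where "z = z1 @ z2" "map f w' = map f z1" "y = map f z2"
        by (metis append_eq_map_conv)
      moreover from this have "w' = z1" using \<open>inj f\<close> by (simp add: inj_map_eq_map)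
      ultimately show "y \<in> map f ` quot L w'" using z by (auto simp: quot_def)
    next
      assume "y \<in> map f ` quot L w'"
      then show "map f w' @ y \<in> map f ` L" by (force simp: quot_def simp flip: map_append)
    qed
    then show ?thesis by (auto simp: quot_def w)
  next
    case False
    then have "quot (map f ` L) w = {}"
      by (auto simp: quot_def) (metis append_eq_map_conv rangeI)
    then show ?thesis by simp
  qed
qed

text \<open>Subset construction: after reading \<open>w\<close>, all that matters is the set of
  states from which \<open>rev w\<close> leads to acceptance.\<close>

lemma regular_rev:
  assumes "regular L"
  shows "regular (rev ` L)"
proof -
  obtain Q q0 \<delta> F where Q: "finite (Q :: nat set)" "q0 \<in> Q" "\<forall>q\<in>Q. \<forall>x. \<delta> q x \<in> Q"
    and L: "L = {w. foldl \<delta> q0 w \<in> F}"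
    using assms unfolding regular_def by blast
  have run: "foldl \<delta> q0 w \<in> Q" for w
    using Q(2,3) by (induction w rule: rev_induct) auto
  show ?thesis
  proof (rule regular_by_quotients)
    show "finite ((\<lambda>S. {y. foldl \<delta> q0 (rev y) \<in> S}) ` Pow Q)" using Q(1) by simp
    show "quot (rev ` L) w \<in> (\<lambda>S. {y. foldl \<delta> q0 (rev y) \<in> S}) ` Pow Q" for w
    proof (rule image_eqI)
      have "v \<in> rev ` L \<longleftrightarrow> rev v \<in> L" for v by (metis image_iff rev_rev_ident)
      then show "quot (rev ` L) w =
          {y. foldl \<delta> q0 (rev y) \<in> {q \<in> Q. foldl \<delta> q (rev w) \<in> F}}"
        by (auto simp: quot_def L run)
    qed auto
  qed
qed

lemma regular_diff_eps:
  assumes "regular L"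
  shows "regular (L - {[]})"
proof (rule regular_by_quotients)
  show "finite (insert (L - {[]}) (range (quot L)))"
    using assms by (simp add: regular_iff_finite_quotients)
  show "quot (L - {[]}) w \<in> insert (L - {[]}) (range (quot L))" for w
  proof (cases "w = []")
    case False
    then have "quot (L - {[]}) w = quot L w" by (auto simp: quot_def)
    then show ?thesis by simp
  qed (simp add: quot_simps)
qed

text \<open>The automaton for the shifted language remembers the last letter read in the first component.\<close>

lemma regular_shift:
  fixes D :: "('x::finite \<times> 'y) list set"
  assumes "regular D"
  shows "regular {zip (us @ [t]) vs | us vs. length vs = Suc (length us) \<and> zip (t # us) vs \<in> D}"
    (is "regular ?E")
proof -
  obtain Q q0 \<delta> F where Q: "finite (Q :: nat set)" "q0 \<in> Q" "\<forall>q\<in>Q. \<forall>x. \<delta> q x \<in> Q"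
    and D: "D = {w. foldl \<delta> q0 w \<in> F}"
    using assms unfolding regular_def by blast
  define \<gamma> where "\<gamma> = (\<lambda>p z. (\<delta> (fst p) (snd p, snd z), fst z) :: nat \<times> 'x)"
  have fold: "foldl \<gamma> (q, s) (zip (us @ [r]) vs) = (foldl \<delta> q (zip (s # us) vs), r)"
    if "length vs = Suc (length us)" for q s r us and vs :: "'y list"
    using that
  proof (induction us arbitrary: q s vs)
    case Nil
    then show ?case by (cases vs) (auto simp: \<gamma>_def)
  next
    case (Cons x us)
    then show ?case by (cases vs) (auto simp: \<gamma>_def)
  qed
  have "regular (?E \<union> {w. w = [] \<and> q0 \<in> F})"
  proof (rule regularI[of "Q \<times> UNIV" "(q0, t)" \<gamma> _ "F \<times> {t}"])
    fix w :: "('x \<times> 'y) list"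
    show "w \<in> ?E \<union> {w. w = [] \<and> q0 \<in> F} \<longleftrightarrow> foldl \<gamma> (q0, t) w \<in> F \<times> {t}"
    proof (cases w rule: rev_cases)
      case Nil
      then show ?thesis by auto
    next
      case (snoc w' z)
      define us vs r where "us = map fst w'" and "vs = map snd w" and "r = fst z"
      have w: "w = zip (us @ [r]) vs" and len: "length vs = Suc (length us)"
        by (simp_all add: us_def vs_def r_def snoc zip_map_fst_snd)
      have "w \<in> ?E \<longleftrightarrow> r = t \<and> zip (t # us) vs \<in> D"
      proof
        assume "w \<in> ?E"
        then obtain us' vs' where E: "w = zip (us' @ [t]) vs'" "length vs' = Suc (length us')"
          "zip (t # us') vs' \<in> D" by blast
        then have "map fst w = us' @ [t]" "map snd w = vs'" by auto
        moreover have "map fst w = us @ [r]" using w len by simp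
        ultimately show "r = t \<and> zip (t # us) vs \<in> D" using E vs_def by auto
      qed (use w len in blast)
      moreover have "w \<noteq> []" using snoc by simp
      ultimately show ?thesis using fold[OF len, of q0 t r] w by (auto simp: D)
    qed
  qed (use Q in \<open>auto simp: \<gamma>_def\<close>)
  then have "regular ((?E \<union> {w. w = [] \<and> q0 \<in> F}) - {[]})"
    by (rule regular_diff_eps)
  moreover have "(?E \<union> {w. w = [] \<and> q0 \<in> F}) - {[]} = ?E"
    by auto
  ultimately show ?thesis by simp
qed

section \<open>Biautomaticity\<close>

lemma lists_singleton: "lists {x} = range (\<lambda>n. replicate n x)"
proof (intro subset_antisym subsetI)
  fix w assume "w \<in> lists {x}"
  then have "replicate (length w) x = w"
    by (intro replicate_length_same) auto
  then show "w \<in> range (\<lambda>n. replicate n x)" by (metis rangeI)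
qed auto

lemma concI: "u \<in> K \<Longrightarrow> v \<in> L \<Longrightarrow> u @ v \<in> K \<cdot> L"
  by (auto simp: conc_def)

lemma concE:
  assumes "w \<in> K \<cdot> L"
  obtains u v where "w = u @ v" "u \<in> K" "v \<in> L"
  using assms by (auto simp: conc_def)

lemma regular_word: "regular {w}"
proof (induction w)
  case (Cons x w)
  have "{x # w} = {[x]} \<cdot> {w}" by (simp add: conc_def)
  with Cons show ?case by (simp only:) (intro regular_conc regular_single)
qed (rule regular_eps)

lemma regular_pattern2:
  "regular {s @ replicate i p @ t @ replicate j q | i j. True}"
proof -
  have "{s @ replicate i p @ t @ replicate j q | i j. True} =
      {s} \<cdot> lists {p} \<cdot> {t} \<cdot> lists {q}"
    unfolding conc_def lists_singleton by blast
  then show ?thesis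
    by (simp only:) (intro regular_conc regular_lists regular_word)
qed

text \<open>Sorted normal forms, and the padded pairs formed from them, consist of at most three
  blocks of equal letters joined by fixed words.\<close>

lemma regular_pattern3:
  "regular {s @ replicate i p @ t @ replicate j q @ replicate k r @ t' | i j k. True}"
proof -
  have "{s @ replicate i p @ t @ replicate j q @ replicate k r @ t' | i j k. True} =
      {s} \<cdot> lists {p} \<cdot> {t} \<cdot> lists {q} \<cdot> lists {r} \<cdot> {t'}" (is "?L = ?R")
  proof (intro subset_antisym subsetI)
    fix w assume "w \<in> ?L"
    then show "w \<in> ?R" by clarify (intro concI; auto)
  next
    fix w assume "w \<in> ?R"
    then show "w \<in> ?L"
      unfolding lists_singleton by (elim concE imageE singletonE rangeE) (simp only:, blast)
  qed
  then show ?thesis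
    by (simp only:) (intro regular_conc regular_lists regular_word)
qed

section \<open>Exchange of left and right padding\<close>

lemma padR_Suc:
  "length v = Suc (length u) \<Longrightarrow> padR u v = zip (map Some u @ [None]) (map Some v)"
  by (simp add: padR_def Let_def)

lemma padL_Suc:
  "length v = Suc (length u) \<Longrightarrow> padL u v = zip (None # map Some u) (map Some v)"
  by (simp add: padL_def Let_def)

lemma padL_rev: "padL (rev u) (rev v) = rev (padR u v)"
proof -
  have "length (map Some u @ replicate (max (length u) (length v) - length u) None) =
      length (map Some v @ replicate (max (length u) (length v) - length v) None)" by simp
  from zip_rev[OF this] show ?thesis by (simp add: padL_def padR_def Let_def rev_map)
qed

lemma deltaL_rev: "deltaL (map_prod rev rev ` P) = rev ` deltaR P"
  by (auto simp: deltaL_def deltaR_def padL_rev image_image split: prod.split intro!: image_cong)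

lemma deltaR_rev: "deltaR (map_prod rev rev ` P) = rev ` deltaL P"
proof -
  have "padR (rev u) (rev v) = rev (padL u v)" for u v :: "'a list"
    using padL_rev[of "rev u" "rev v"] by simp
  then show ?thesis
    by (auto simp: deltaL_def deltaR_def image_image split: prod.split intro!: image_cong)
qed

text \<open>As the second word is longer by exactly one letter, moving the padding from the left to
  the right shifts the first component by one place, which is the situation of
  \<open>regular_shift\<close>.\<close>

lemma regular_deltaL_imp_deltaR:
  fixes P :: "('x::finite list \<times> 'x list) set"
  assumes len: "\<And>u v. (u, v) \<in> P \<Longrightarrow> length v = Suc (length u)"
    and reg: "regular (deltaL P)"
  shows "regular (deltaR P)"
proof -
  have "deltaR P = {zip (us @ [None]) vs | us vs. length vs = Suc (length us) \<and>
      zip (None # us) vs \<in> deltaL P}" (is "_ = ?E")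
  proof (intro subset_antisym subsetI)
    fix w assume "w \<in> deltaR P"
    then obtain u v where uv: "(u, v) \<in> P" "w = padR u v" by (auto simp: deltaR_def)
    then have "padL u v \<in> deltaL P" by (auto simp: deltaL_def)
    with uv len[OF uv(1)] show "w \<in> ?E"
      by (intro CollectI exI[of _ "map Some u"] exI[of _ "map Some v"])
        (simp add: padR_Suc padL_Suc)
  next
    fix w assume "w \<in> ?E"
    then obtain us vs u v where E: "w = zip (us @ [None]) vs" "length vs = Suc (length us)"
      "zip (None # us) vs = padL u v" "(u, v) \<in> P" by (auto simp: deltaL_def)
    \<comment> \<open>The padded word determines the pair, so comparing the two projections recovers
      \<open>us\<close> and \<open>vs\<close>.\<close>
    have z: "zip (None # us) vs = zip (None # map Some u) (map Some v)"
      using E(3) len[OF E(4)] by (simp add: padL_Suc)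
    have "map fst (zip (None # us) vs) = None # us" "map snd (zip (None # us) vs) = vs"
      using E(2) by auto
    moreover have "map fst (zip (None # us) vs) = None # map Some u"
      "map snd (zip (None # us) vs) = map Some v"
      unfolding z using len[OF E(4)] by auto
    ultimately have "us = map Some u" "vs = map Some v" by auto
    then have "w = padR u v" using E(1) len[OF E(4)] by (simp add: padR_Suc)
    then show "w \<in> deltaR P" using E(4) by (force simp: deltaR_def)
  qed
  then show ?thesis using regular_shift[OF reg, of None] by simp
qed

text \<open>Reversing both words exchanges the two paddings and reduces this direction to the
  previous one.\<close>

lemma regular_deltaR_imp_deltaL:
  fixes P :: "('x::finite list \<times> 'x list) set"
  assumes "\<And>u v. (u, v) \<in> P \<Longrightarrow> length v = Suc (length u)"
    and "regular (deltaR P)"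
  shows "regular (deltaL P)"
proof -
  have "regular (deltaR (map_prod rev rev ` P))"
    by (rule regular_deltaL_imp_deltaR) (use assms in \<open>auto simp: deltaL_rev intro: regular_rev\<close>)
  then have "regular (rev ` rev ` deltaL P)"
    unfolding deltaR_rev by (rule regular_rev)
  then show ?thesis by (simp add: image_image)
qed

definition graph_on :: "('u \<Rightarrow> 'v) \<Rightarrow> 'u set \<Rightarrow> ('u \<times> 'v) set" where
  "graph_on f K = (\<lambda>u. (u, f u)) ` K"

lemma graph_on_Un: "graph_on f (K \<union> K') = graph_on f K \<union> graph_on f K'"
  by (simp add: graph_on_def image_Un)

lemma deltaR_Un: "deltaR (P \<union> P') = deltaR P \<union> deltaR P'"
  and deltaL_Un: "deltaL (P \<union> P') = deltaL P \<union> deltaL P'"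
  by (simp_all add: deltaR_def deltaL_def image_Un)

lemma deltaR_graph_on: "deltaR (graph_on f K) = (\<lambda>u. padR u (f u)) ` K"
  and deltaL_graph_on: "deltaL (graph_on f K) = (\<lambda>u. padL u (f u)) ` K"
  by (simp_all add: deltaR_def deltaL_def graph_on_def image_image)

abbreviation diag :: "'x \<Rightarrow> 'x option \<times> 'x option" where
  "diag x \<equiv> (Some x, Some x)"

abbreviation pad :: "'x \<Rightarrow> 'x option \<times> 'x option" where
  "pad x \<equiv> (None, Some x)"

lemma padR_snoc: "padR u (u @ [x]) = map diag u @ [pad x]"
  by (simp add: padR_Suc zip_map_map zip_same_conv_map)

lemma padL_Cons: "padL u (x # u) = pad x # map diag u"
  by (simp add: padL_Suc zip_map_map zip_same_conv_map)

lemma regular_deltaR_snoc: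
  assumes "regular K" "\<And>u. u \<in> K \<Longrightarrow> f u = u @ [x]"
  shows "regular (deltaR (graph_on f K))"
proof -
  have "deltaR (graph_on f K) = map diag ` K \<cdot> {[pad x]}"
    using assms(2) by (auto simp: deltaR_graph_on conc_def padR_snoc image_iff)
  moreover have "inj (diag :: 'a \<Rightarrow> _)" by (simp add: inj_def)
  ultimately show ?thesis by (simp add: assms(1) regular_conc regular_map regular_single)
qed

lemma regular_deltaL_Cons:
  assumes "regular K" "\<And>u. u \<in> K \<Longrightarrow> f u = x # u"
  shows "regular (deltaL (graph_on f K))"
proof -
  have "deltaL (graph_on f K) = {[pad x]} \<cdot> map diag ` K"
    using assms(2) by (auto simp: deltaL_graph_on conc_def padL_Cons image_iff)
  moreover have "inj (diag :: 'a \<Rightarrow> _)" by (simp add: inj_def)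
  ultimately show ?thesis by (simp add: assms(1) regular_conc regular_map regular_single)
qed

section \<open>Multiplication of normal forms by a letter\<close>

definition csorted :: "nat \<Rightarrow> nat \<Rightarrow> nat \<Rightarrow> gen list" where
  "csorted i j k = replicate (Suc i) c @ replicate j b @ replicate k a"

definition NFc :: "gen list set" where
  "NFc = {csorted i j k | i j k. True}"

lemma NF_eq: "NF = lists {a, b} \<union> NFc"
  by (simp add: NF_def NFc_def csorted_def)

lemma image_NFc: "F ` NFc = {F (csorted i j k) | i j k. True}"
  unfolding NFc_def by blast

lemma regular_NFc: "regular NFc"
  using regular_pattern3[of "[c]" c "[]" b a "[]"] by (simp add: NFc_def csorted_def)

lemma regular_NF: "regular NF"
  unfolding NF_eq by (intro regular_Un regular_NFc regular_lists)

lemma strip_replicate [simp]: "strip (replicate n c) = []" "strip (replicate n b) = replicate n b"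
     "strip (replicate n a) = replicate n a"
  by (auto simp: strip_def)

lemma cdeg_replicate [simp]: "cdeg (replicate n c) = n" "cdeg (replicate n b) = 0"
    "cdeg (replicate n a) = 0"
  by (induction n) auto

lemma length_nf [simp]: "length (nf w) = length w"
  using atail_le[of "strip w"] length_cdeg_strip[of w] by (simp add: nf_def)

lemma nf_csorted: "nf (csorted i j k) = csorted i j k"
  using nf_normal by (simp add: csorted_def)

lemma map_csorted: "map Some (csorted i j k) =
    replicate i (Some c) @ [Some c] @ replicate j (Some b) @ replicate k (Some a)"
  by (simp add: csorted_def replicate_app_Cons_same)

lemma padL_csorted: "length v = Suc (length (csorted i j k)) \<Longrightarrow> padL (csorted i j k) v =
    zip (None # replicate i (Some c) @ [Some c] @ replicate j (Some b) @ replicate k (Some a))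
      (map Some v)"
  by (simp add: padL_Suc map_csorted)

lemma length_csorted: "length (csorted i j k) = Suc (i + j + k)"
  by (simp add: csorted_def)

lemma nf_csorted_a: "nf (csorted i j k @ [a]) = csorted i j (Suc k)"
  using nf_csorted[of i j "Suc k"] by (simp add: csorted_def replicate_append_same)

lemma nf_csorted_b: "nf (csorted i j k @ [b]) = csorted i (Suc (j + k)) 0"
  by (simp add: csorted_def nf_def atail_append atail_Cons)

text \<open>A new first letter a survives only if no b follows; otherwise it joins the block of
  letters b.\<close>

lemma nf_a_csorted: "nf (a # csorted i j k) =
    (if j = 0 then csorted i 0 (Suc k) else csorted i (Suc j) k)"
  by (cases j) (simp_all add: csorted_def nf_def atail_append atail_Cons atail_zero
      set_replicate_conv_if numeral_2_eq_2)

lemma nf_b_csorted: "nf (b # csorted i j k) = csorted i (Suc j) k"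
  by (cases j) (simp_all add: csorted_def nf_def atail_append atail_Cons atail_zero
      set_replicate_conv_if numeral_2_eq_2)

lemma nf_c_csorted: "nf (c # csorted i j k) = csorted (Suc i) j k"
  by (auto simp add: csorted_def nf_def atail_append atail_zero)

text \<open>Right multiplication by \<open>a\<close> or \<open>b\<close> keeps the beginning of a normal form, so the two words stay
  aligned with padding on the right; for left multiplication this holds with padding on the left.
  The other padding comes for free from the shift, since a product with a letter is longer by one.\<close>

lemma regular_right_a: "regular (deltaR (graph_on (\<lambda>u. nf (u @ [a])) NF))"
proof (rule regular_deltaR_snoc[OF regular_NF])
  fix u assume "u \<in> NF"
  then consider "u \<in> lists {a, b}" | i j k where "u = csorted i j k"
    by (auto simp: NF_eq NFc_def)
  then show "nf (u @ [a]) = u @ [a]"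
  proof cases
    case 1
    then show ?thesis by (intro nf_ab) (simp add: cdeg_0_iff)
  next
    case 2
    then show ?thesis
      by (simp add: nf_csorted_a) (simp add: csorted_def replicate_append_same)
  qed
qed

text \<open>On words with a c, the appended b turns the final block of letters a into letters b
  place by place, so the padded pair is again a word of blocks.\<close>

lemma regular_right_b: "regular (deltaR (graph_on (\<lambda>u. nf (u @ [b])) NF))"
  unfolding NF_eq graph_on_Un deltaR_Un
proof (rule regular_Un)
  show "regular (deltaR (graph_on (\<lambda>u. nf (u @ [b])) (lists {a, b})))"
    by (rule regular_deltaR_snoc[OF regular_lists, of _ _ b]) (simp add: nf_ab cdeg_0_iff)
  have "padR (csorted i j k) (nf (csorted i j k @ [b])) =
      [diag c] @ replicate i (diag c) @ [] @ replicate j (diag b) @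
        replicate k (Some a, Some b) @ [pad b]"
    for i j k
  proof -
    have "csorted i (Suc (j + k)) 0 = replicate (Suc i) c @ replicate j b @ replicate k b @ [b]"
      using replicate_add[of j "Suc k" b] by (simp add: csorted_def replicate_append_same)
    then show ?thesis unfolding nf_csorted_b by (simp add: padR_Suc csorted_def)
  qed
  then show "regular (deltaR (graph_on (\<lambda>u. nf (u @ [b])) NFc))"
    unfolding deltaR_graph_on image_NFc by (simp only: regular_pattern3)
qed

lemma regular_left_b: "regular (deltaL (graph_on (\<lambda>u. nf (b # u)) NF))"
  unfolding NF_eq graph_on_Un deltaL_Un
proof (rule regular_Un)
  show "regular (deltaL (graph_on (\<lambda>u. nf (b # u)) (lists {a, b})))"
    by (rule regular_deltaL_Cons[OF regular_lists, of _ _ b]) (simp add: nf_ab cdeg_0_iff)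
  \<comment> \<open>The padding shifts the first component by one place, so its last c faces the new
    b.\<close>
  have "padL (csorted i j k) (nf (b # csorted i j k)) =
      [pad c] @ replicate i (diag c) @ [(Some c, Some b)] @ replicate j (diag b) @
        replicate k (diag a) @ []" for i j k
    by (simp add: padL_csorted nf_b_csorted length_csorted) (simp add: csorted_def)
  then show "regular (deltaL (graph_on (\<lambda>u. nf (b # u)) NFc))"
    unfolding deltaL_graph_on image_NFc by (simp only: regular_pattern3)
qed

text \<open>The new letter stays a or becomes b according to whether the block of letters b is
  empty, so the sorted words are split accordingly.\<close>

lemma regular_left_a: "regular (deltaL (graph_on (\<lambda>u. nf (a # u)) NF))"
proof -
  let ?N0 = "{csorted i 0 k | i k. True}" and ?N1 = "{csorted i (Suc j) k | i j k. True}"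
  have split: "NFc = ?N0 \<union> ?N1"
    unfolding NFc_def by (auto, metis not0_implies_Suc)
  have "regular (deltaL (graph_on (\<lambda>u. nf (a # u)) (lists {a, b})))"
    by (rule regular_deltaL_Cons[OF regular_lists, of _ _ a]) (simp add: nf_ab cdeg_0_iff)
  moreover have "regular (deltaL (graph_on (\<lambda>u. nf (a # u)) ?N0))"
  proof -
    have "padL (csorted i 0 k) (nf (a # csorted i 0 k)) =
        [pad c] @ replicate i (diag c) @ [(Some c, Some a)] @ replicate k (diag a)" for i k
      by (simp add: padL_csorted nf_a_csorted length_csorted) (simp add: csorted_def)
    moreover have "F ` ?N0 = {F (csorted i 0 k) | i k. True}"
      for F :: "gen list \<Rightarrow> (gen option \<times> gen option) list"
      by blast
    ultimately show ?thesis
      unfolding deltaL_graph_on by (simp only: regular_pattern2)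
  qed
  moreover have "regular (deltaL (graph_on (\<lambda>u. nf (a # u)) ?N1))"
  proof -
    have "padL (csorted i (Suc j) k) (nf (a # csorted i (Suc j) k)) =
        [pad c] @ replicate i (diag c) @ [(Some c, Some b), diag b] @ replicate j (diag b) @
          replicate k (diag a) @ []" for i j k
      by (simp add: padL_csorted nf_a_csorted length_csorted) (simp add: csorted_def)
    moreover have "F ` ?N1 = {F (csorted i (Suc j) k) | i j k. True}"
      for F :: "gen list \<Rightarrow> (gen option \<times> gen option) list"
      by blast
    ultimately show ?thesis
      unfolding deltaL_graph_on by (simp only: regular_pattern3)
  qed
  ultimately show ?thesis
    unfolding NF_eq split graph_on_Un deltaL_Un by (intro regular_Un)
qed

lemma ab_split:
  assumes "u \<in> lists {a, b}"
  obtains (power) k where "u = replicate k a"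
  | (split) v k where "u = v @ [b] @ replicate k a" "v \<in> lists {a, b}"
proof -
  have "(\<exists>k. u = replicate k a) \<or> (\<exists>v k. u = v @ [b] @ replicate k a \<and> v \<in> lists {a, b})"
    using assms
  proof (induction u rule: rev_induct)
    case (snoc x u)
    then have u: "u \<in> lists {a, b}" and x: "x = a \<or> x = b" by auto
    have suc: "replicate k a @ [a] = replicate (Suc k) a" for k
      by (simp add: replicate_append_same)
    show ?case
    proof (cases "x = b")
      case True
      then have "u @ [x] = u @ [b] @ replicate 0 a" by simp
      with u show ?thesis by blast
    next
      case False
      with x snoc.IH[OF u] show ?thesis by (metis append.assoc suc)
    qed
  qed (metis replicate_0)
  then show thesis using power split by blast
qed

text \<open>A c put in front of a word over a and b turns every letter before the last b into b and
  keeps the final block of letters a. With padding on the left this acts letter by letter, through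
  \<open>?h\<close> up to the last b and diagonally from there on.\<close>

lemma regular_left_c: "regular (deltaL (graph_on (\<lambda>u. nf (c # u)) NF))"
  unfolding NF_eq graph_on_Un deltaL_Un
proof (rule regular_Un)
  show "regular (deltaL (graph_on (\<lambda>u. nf (c # u)) NFc))"
    by (rule regular_deltaL_Cons[OF regular_NFc, of _ c])
      (clarsimp simp: NFc_def nf_c_csorted, simp add: csorted_def)
  let ?h = "\<lambda>x. (Some x, Some b)"
  have short: "padL (replicate k a) (nf (c # replicate k a)) = pad c # replicate k (diag a)" for k
    by (simp add: padL_Suc nf_def)
  have long: "padL (v @ [b] @ replicate k a) (nf (c # v @ [b] @ replicate k a)) =
      [pad c] @ map ?h v @ [diag b] @ replicate k (diag a)" if "v \<in> lists {a, b}" for v k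
  proof -
    have v: "strip v = v" "cdeg v = 0"
      using that by (simp_all add: strip_id_iff cdeg_0_iff)
    then have "nf (c # v @ [b] @ replicate k a) =
        [c] @ replicate (length v) b @ [b] @ replicate k a"
      by (simp add: nf_def atail_append atail_Cons replicate_app_Cons_same)
    moreover have "zip (map Some v) (replicate (length v) (Some b)) = map ?h v"
      by (induction v) auto
    ultimately show ?thesis by (simp add: padL_Suc)
  qed
  have "deltaL (graph_on (\<lambda>u. nf (c # u)) (lists {a, b})) =
      {[pad c]} \<cdot> lists {diag a} \<union>
      {[pad c]} \<cdot> map ?h ` lists {a, b} \<cdot> {[diag b]} \<cdot> lists {diag a}" (is "?L = ?R")
  proof (intro subset_antisym subsetI)
    fix w assume "w \<in> ?L"
    then obtain u where u: "u \<in> lists {a, b}" "w = padL u (nf (c # u))"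
      unfolding deltaL_graph_on by blast
    from u(1) show "w \<in> ?R"
    proof (cases rule: ab_split)
      case (power k)
      then have w: "w = [pad c] @ replicate k (diag a)" using u short by simp
      have "w \<in> {[pad c]} \<cdot> lists {diag a}"
        unfolding w by (intro concI) auto
      then show ?thesis ..
    next
      case (split v k)
      then have w: "w = [pad c] @ map ?h v @ [diag b] @ replicate k (diag a)"
        using u long by simp
      have "w \<in> {[pad c]} \<cdot> map ?h ` lists {a, b} \<cdot> {[diag b]} \<cdot> lists {diag a}"
        unfolding w by (intro concI imageI split(2)) auto
      then show ?thesis ..
    qed
  next
    fix w assume "w \<in> ?R"
    then show "w \<in> ?L"
    proof
      assume "w \<in> {[pad c]} \<cdot> lists {diag a}"
      then obtain k where "w = [pad c] @ replicate k (diag a)"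
        by (auto elim!: concE simp: lists_singleton)
      then have "w = padL (replicate k a) (nf (c # replicate k a))" using short by simp
      moreover have "replicate k a \<in> lists {a, b}" by auto
      ultimately show ?thesis unfolding deltaL_graph_on by (rule image_eqI)
    next
      assume "w \<in> {[pad c]} \<cdot> map ?h ` lists {a, b} \<cdot> {[diag b]} \<cdot> lists {diag a}"
      then obtain v t where v: "v \<in> lists {a, b}" "t \<in> lists {diag a}"
        "w = [pad c] @ map ?h v @ [diag b] @ t"
        by (elim concE imageE) simp
      then obtain k where "t = replicate k (diag a)" by (auto simp: lists_singleton)
      then have "w = padL (v @ [b] @ replicate k a) (nf (c # v @ [b] @ replicate k a))"
        using long v by simp
      moreover have "v @ [b] @ replicate k a \<in> lists {a, b}" using v by auto
      ultimately show ?thesis unfolding deltaL_graph_on by (rule image_eqI)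
    qed
  qed
  moreover have "inj ?h" by (simp add: inj_def)
  ultimately show "regular (deltaL (graph_on (\<lambda>u. nf (c # u)) (lists {a, b})))"
    by (simp only:) (intro regular_Un regular_conc regular_single regular_lists regular_map)
qed

section \<open>The automatic structure over an alphabet of natural numbers\<close>

lemma UNIV_gen: "(UNIV :: gen set) = {a, b, c}"
  using gen.exhaust by blast

fun code :: "gen \<Rightarrow> nat" where
  "code a = 0" | "code b = 1" | "code c = 2"

definition decode :: "nat \<Rightarrow> gen" where
  "decode n = (if n = 0 then a else if n = 1 then b else c)"

lemma decode_code [simp]: "decode (code x) = x"
  by (cases x) (auto simp: decode_def)

lemma inj_code: "inj code"
  by (metis decode_code injI)

lemma range_code: "range code = {0, 1, 2}"
proof -
  have "range code = code ` {a, b, c}" by (simp add: UNIV_gen)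
  then show ?thesis by simp
qed

definition genM :: "nat \<Rightarrow> gen list set" where
  "genM n = pclass UNIV relsM [decode n]"

lemma evalw_genM: "evalw monM genM (map code u) = pclass UNIV relsM u"
proof -
  have "concat (map (\<lambda>x. [decode x]) (map code u)) = u"
    by (induction u) auto
  then show ?thesis
    using M.evalw_pclass[of "map code u" UNIV "\<lambda>x. [decode x]"]
    by (simp add: genM_def[abs_def] monM_def)
qed

lemma deltaR_map: "deltaR (map_prod (map f) (map f) ` P) =
    map (map_prod (map_option f) (map_option f)) ` deltaR P"
  and deltaL_map: "deltaL (map_prod (map f) (map f) ` P) =
    map (map_prod (map_option f) (map_option f)) ` deltaL P"
proof -
  have pads: "map Some (map f u) @ replicate n None =
      map (map_option f) (map Some u @ replicate n None)"
    "replicate n None @ map Some (map f u) =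
      map (map_option f) (replicate n None @ map Some u)" for n u
    by auto
  have "padR (map f u) (map f v) = map (map_prod (map_option f) (map_option f)) (padR u v)"
    "padL (map f u) (map f v) = map (map_prod (map_option f) (map_option f)) (padL u v)" for u v
    unfolding padR_def padL_def Let_def length_map pads zip_map_map map_prod_def by (rule refl)+
  then show "deltaR (map_prod (map f) (map f) ` P) =
    map (map_prod (map_option f) (map_option f)) ` deltaR P"
    "deltaL (map_prod (map f) (map f) ` P) =
    map (map_prod (map_option f) (map_option f)) ` deltaL P"
    by (simp_all add: deltaR_def deltaL_def image_image case_prod_unfold)
qed

lemma regular_code:
  "regular (deltaR P) \<Longrightarrow> regular (deltaR (map_prod (map code) (map code) ` P))"
  "regular (deltaL P) \<Longrightarrow> regular (deltaL (map_prod (map code) (map code) ` P))"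
  unfolding deltaR_map deltaL_map
  by (intro regular_map prod.inj_map option.inj_map inj_code; assumption)+

text \<open>Uniqueness of normal forms makes the relation functional: the normal form of the product
  is the only possible partner of \<open>u\<close>.\<close>

lemma Lright_eq: "Lright monM genM (map code ` NF) (code x) =
    map_prod (map code) (map code) ` graph_on (\<lambda>u. nf (u @ [x])) NF"
proof -
  have iff: "evalw monM genM (map code u) \<otimes>\<^bsub>monM\<^esub> genM (code x) = evalw monM genM (map code v) \<longleftrightarrow>
      v = nf (u @ [x])" if "v \<in> NF" for u v
    using nf_fixes_NF[OF that] unfolding evalw_genM
    by (auto simp: genM_def M.pclass_mult monM_def M.pclass_eq_iff cong_iff)
  then have "evalw monM genM (map code u) \<otimes>\<^bsub>monM\<^esub> genM (code x) =
      evalw monM genM (map code (nf (u @ [x])))" for u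
    using nf_in_NF by blast
  with iff show ?thesis
    unfolding Lright_def graph_on_def image_image
    by (intro subset_antisym subsetI) (fastforce, clarsimp simp: nf_in_NF)
qed

lemma Lleft_eq: "Lleft monM genM (map code ` NF) (code x) =
    map_prod (map code) (map code) ` graph_on (\<lambda>u. nf (x # u)) NF"
proof -
  have iff: "genM (code x) \<otimes>\<^bsub>monM\<^esub> evalw monM genM (map code u) = evalw monM genM (map code v) \<longleftrightarrow>
      v = nf (x # u)" if "v \<in> NF" for u v
    using nf_fixes_NF[OF that] unfolding evalw_genM
    by (auto simp: genM_def M.pclass_mult monM_def M.pclass_eq_iff cong_iff)
  then have "genM (code x) \<otimes>\<^bsub>monM\<^esub> evalw monM genM (map code u) =
      evalw monM genM (map code (nf (x # u)))" for u
    using nf_in_NF by blast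
  with iff show ?thesis
    unfolding Lleft_def graph_on_def image_image
    by (intro subset_antisym subsetI) (fastforce, clarsimp simp: nf_in_NF)
qed

lemma right_c_eq_left_c: "nf (u @ [c]) = nf (c # u)"
proof -
  have "c # u \<approx> u @ [c]" using central[of 1 u] by simp
  then show ?thesis by (simp add: cong_iff)
qed

instance gen :: finite
  by standard (simp add: UNIV_gen)

lemma regular_right: "regular (deltaR (graph_on (\<lambda>u. nf (u @ [x])) NF))"
    "regular (deltaL (graph_on (\<lambda>u. nf (u @ [x])) NF))"
proof -
  have len: "length v = Suc (length u)" if "(u, v) \<in> graph_on (\<lambda>u. nf (u @ [x])) NF" for u v
    using that by (auto simp: graph_on_def)
  \<comment> \<open>For a and b the right padding was treated directly, for the central letter c the
    left one. The length condition supplies the other padding in each case.\<close>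
  have "regular (deltaR (graph_on (\<lambda>u. nf (u @ [x])) NF)) \<or>
      regular (deltaL (graph_on (\<lambda>u. nf (u @ [x])) NF))"
    using regular_right_a regular_right_b regular_left_c
    by (cases x) (simp_all add: right_c_eq_left_c)
  then show "regular (deltaR (graph_on (\<lambda>u. nf (u @ [x])) NF))"
    "regular (deltaL (graph_on (\<lambda>u. nf (u @ [x])) NF))"
    using regular_deltaL_imp_deltaR[OF len] regular_deltaR_imp_deltaL[OF len] by auto
qed

lemma regular_left: "regular (deltaR (graph_on (\<lambda>u. nf (x # u)) NF))"
    "regular (deltaL (graph_on (\<lambda>u. nf (x # u)) NF))"
proof -
  have len: "length v = Suc (length u)" if "(u, v) \<in> graph_on (\<lambda>u. nf (x # u)) NF" for u v
    using that by (auto simp: graph_on_def)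
  show L: "regular (deltaL (graph_on (\<lambda>u. nf (x # u)) NF))"
    using regular_left_a regular_left_b regular_left_c by (cases x) auto
  show "regular (deltaR (graph_on (\<lambda>u. nf (x # u)) NF))"
    using regular_deltaL_imp_deltaR[OF len L] .
qed

lemma auto_structure_NF: "auto_structure monM {0, 1, 2} genM (map code ` NF)"
  unfolding auto_structure_def
proof (intro conjI)
  show "genM ` {0, 1, 2} \<subseteq> carrier monM"
    by (auto simp: genM_def monM_def M.pclass_in_carrier)
  show "map code ` NF \<subseteq> lists {0, 1, 2}"
    unfolding range_code[symmetric] by auto
  show "regular (map code ` NF)"
    by (intro regular_map regular_NF inj_code)
  have "evalw monM genM ` map code ` NF = pclass UNIV relsM ` NF"
    by (simp add: image_image evalw_genM)
  also have "\<dots> = carrier monM"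
  proof
    show "pclass UNIV relsM ` NF \<subseteq> carrier monM"
      by (auto simp: monM_def M.pclass_in_carrier)
    show "carrier monM \<subseteq> pclass UNIV relsM ` NF"
      using unique_normal_form by blast
  qed
  finally show "evalw monM genM ` map code ` NF = carrier monM" .
qed simp

lemma biautomatic_monM: "biautomatic monM"
proof -
  have "regular (deltaR (Lright monM genM (map code ` NF) n)) \<and>
      regular (deltaR (Lleft monM genM (map code ` NF) n)) \<and>
      regular (deltaL (Lright monM genM (map code ` NF) n)) \<and>
      regular (deltaL (Lleft monM genM (map code ` NF) n))" if n: "n \<in> {0, 1, 2}" for n
  proof -
    obtain x where "n = code x" using n unfolding range_code[symmetric] by blast
    then show ?thesis
      by (simp add: Lright_eq Lleft_eq regular_code regular_right regular_left)
  qed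
  with auto_structure_NF show ?thesis unfolding biautomatic_def by blast
qed

lemma biautomatic_imp_automatic: "biautomatic G \<Longrightarrow> automatic G"
  unfolding biautomatic_def automatic_def by blast

section \<open>Finite derivation type and complete systems\<close>

lemma esrc_ewhisk [simp]: "esrc (ewhisk u v e) = u @ esrc e @ v"
  and etgt_ewhisk [simp]: "etgt (ewhisk u v e) = u @ etgt e @ v"
  by (cases e; simp)+

lemma ewhisk_ewhisk [simp]: "ewhisk u v (ewhisk u' v' e) = ewhisk (u @ u') (v' @ v) e"
  by (cases e) simp

lemma ewhisk_Nil [simp]: "ewhisk [] [] e = e"
  by (cases e) simp

lemma esrc_einv [simp]: "esrc (einv e) = etgt e" and etgt_einv [simp]: "etgt (einv e) = esrc e"
  by (cases e; simp)+

lemma edge_ok_einv: "edge_ok A R (einv e) = edge_ok A R e"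
  by (cases e) (auto simp: edge_ok_def)

lemma ewhisk_einv: "ewhisk u v (einv e) = einv (ewhisk u v e)"
  by (cases e) simp

lemma edge_ok_ewhisk:
  "edge_ok A R e \<Longrightarrow> u \<in> lists A \<Longrightarrow> v \<in> lists A \<Longrightarrow> edge_ok A R (ewhisk u v e)"
  by (cases e) (auto simp: edge_ok_def)

lemma path_append:
  "is_path A R w es v \<Longrightarrow> is_path A R v fs w' \<Longrightarrow> is_path A R w (es @ fs) w'"
  by (induction es arbitrary: w) auto

context presentation
begin

lemma edge_in_lists: "edge_ok A R e \<Longrightarrow> esrc e \<in> lists A \<and> etgt e \<in> lists A"
  using rels by (cases e) (auto simp: edge_ok_def)

lemma edge_cong: "edge_ok A R e \<Longrightarrow> pcong A R (esrc e) (etgt e)"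
proof -
  assume e: "edge_ok A R e"
  obtain x l r y where xy: "e = (x, l, r, y)" by (cases e)
  with e have "pcong A R l r" "x \<in> lists A" "y \<in> lists A"
    using pcong_rel pcong_sym by (auto simp: edge_ok_def)
  then show ?thesis unfolding xy esrc.simps etgt.simps by (rule pcong_context)
qed

lemma path_in_lists: "is_path A R w es w' \<Longrightarrow> w \<in> lists A \<and> w' \<in> lists A"
  using edge_in_lists by (induction es arbitrary: w) auto

lemma path_cong: "is_path A R w es w' \<Longrightarrow> pcong A R w w'"
proof (induction es arbitrary: w)
  case (Cons e es)
  then show ?case using pcong_trans[OF edge_cong[of e]] by auto
qed (simp add: pcong_refl)

lemma path_whisk:
  "is_path A R w es w' \<Longrightarrow> u \<in> lists A \<Longrightarrow> v \<in> lists A \<Longrightarrow>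
    is_path A R (u @ w @ v) (map (ewhisk u v) es) (u @ w' @ v)"
  by (induction es arbitrary: w) (auto simp: edge_ok_ewhisk)

lemma path_inverse: "is_path A R w es w' \<Longrightarrow> is_path A R w' (rev (map einv es)) w"
proof (induction es arbitrary: w)
  case (Cons e es)
  then have e: "edge_ok A R e" "esrc e = w" by auto
  then have "is_path A R (etgt e) [einv e] w"
    using edge_in_lists[of e] by (simp add: edge_ok_einv)
  moreover have "is_path A R w' (rev (map einv es)) (etgt e)" using Cons by simp
  ultimately have "is_path A R w' (rev (map einv es) @ [einv e]) w" by (rule path_append[rotated])
  then show ?case by simp
qed auto

lemma cong_path: "pcong A R u v \<Longrightarrow> \<exists>es. is_path A R u es v"
proof -
  assume uv: "pcong A R u v"
  then have "sstep\<^sup>*\<^sup>* u v" "u \<in> lists A" by (auto simp: pcong_def)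
  then show ?thesis
  proof (induction rule: rtranclp_induct)
    case base
    then have "is_path A R u [] u" by simp
    then show ?case ..
  next
    case (step v w)
    then obtain es where es: "is_path A R u es v" by blast
    then have v: "v \<in> lists A" using path_in_lists by blast
    obtain x y l r where "(l, r) \<in> R \<or> (r, l) \<in> R" "v = x @ l @ y" "w = x @ r @ y"
      using step(2) by (auto simp: rstep_def)
    then have "is_path A R v [(x, l, r, y)] w"
      using v rels by (auto simp: edge_ok_def)
    with es show ?case using path_append by blast
  qed
qed

end

section \<open>The one-form and its integral over an arbitrary finite presentation\<close>

definition starts_a :: "gen list \<Rightarrow> int" where
  "starts_a s = (if take 1 s = [a] then 1 else 0)"

definition ends_ab :: "gen list \<Rightarrow> int" where
  "ends_ab s = (if take 2 (rev s) = [b, a] then 1 else 0)"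

lemma starts_a_append: "s \<noteq> [] \<Longrightarrow> starts_a (s @ t) = starts_a s"
  by (cases s) (auto simp: starts_a_def)

text \<open>The two tests read one letter at the beginning and two at the end. This is the source of
  the recurring condition that a context has a stripped letter on the left or two on the
  right.\<close>

lemma ends_ab_append: "2 \<le> length t \<Longrightarrow> ends_ab (s @ t) = ends_ab t"
  by (simp add: ends_ab_def)

text \<open>The discrete one-form \<open>q dp\<close>, where \<open>p\<close> tests the beginning and \<open>q\<close> the end of a word.
  Its integral vanishes on circuits along which \<open>p\<close> or \<open>q\<close> is constant, but not on the square in
  which the two ends of a long word are changed independently.\<close>

definition form :: "gen list \<Rightarrow> gen list \<Rightarrow> int" where
  "form s t = ends_ab s * (starts_a t - starts_a s)"

lemma form_self [simp]: "form s s = 0"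
  by (simp add: form_def)

text \<open>A finite presentation of the monoid with representatives for the generators in both
  directions. Equality rather than congruence can be required in \<open>\<phi>_\<psi>\<close>,
  because a single letter is alone in its congruence class.\<close>

locale monM_presentation = presentation A R for A :: "'s set" and R +
  fixes \<phi> :: "'s \<Rightarrow> gen list" and \<psi> :: "gen \<Rightarrow> 's list"
  assumes finite_rels: "finite R"
    and \<phi>_cong: "U \<in> lists A \<Longrightarrow> V \<in> lists A \<Longrightarrow>
      pcong A R U V \<longleftrightarrow> concat (map \<phi> U) \<approx> concat (map \<phi> V)"
    and \<psi>_in_lists: "\<psi> g \<in> lists A"
    and \<phi>_\<psi>: "concat (map \<phi> (\<psi> g)) = [g]"
begin

definition \<sigma> :: "'s list \<Rightarrow> gen list" where
  "\<sigma> W = strip (concat (map \<phi> W))"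

definition \<kappa> :: "'s list \<Rightarrow> nat" where
  "\<kappa> W = cdeg (concat (map \<phi> W))"

definition \<Psi> :: "gen list \<Rightarrow> 's list" where
  "\<Psi> w = concat (map \<psi> w)"

lemma \<sigma>_append [simp]: "\<sigma> (U @ V) = \<sigma> U @ \<sigma> V"
  and \<kappa>_append [simp]: "\<kappa> (U @ V) = \<kappa> U + \<kappa> V"
  by (simp_all add: \<sigma>_def \<kappa>_def)

lemma \<Psi>_append [simp]: "\<Psi> (u @ v) = \<Psi> u @ \<Psi> v"
  by (simp add: \<Psi>_def)

lemma \<Psi>_in_lists: "\<Psi> w \<in> lists A"
  using \<psi>_in_lists by (induction w) (auto simp: \<Psi>_def)

lemma \<phi>_\<Psi>: "concat (map \<phi> (\<Psi> w)) = w"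
  by (induction w) (auto simp: \<Psi>_def \<phi>_\<psi>)

lemma \<sigma>_\<Psi> [simp]: "\<sigma> (\<Psi> w) = strip w"
  and \<kappa>_\<Psi> [simp]: "\<kappa> (\<Psi> w) = cdeg w"
  by (simp_all add: \<sigma>_def \<kappa>_def \<phi>_\<Psi>)

lemma \<Psi>_path: "u \<approx> v \<Longrightarrow> \<exists>es. is_path A R (\<Psi> u) es (\<Psi> v)"
  by (intro cong_path) (simp add: \<phi>_cong \<Psi>_in_lists \<phi>_\<Psi>)

text \<open>The third part rests on the absence of relations between words without c; it makes
  rewrites away from the c invisible to the form.\<close>

lemma cong_degrees:
  assumes "pcong A R U V"
  shows "\<kappa> U = \<kappa> V" "length (\<sigma> U) = length (\<sigma> V)" "\<kappa> U = 0 \<Longrightarrow> \<sigma> U = \<sigma> V"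
proof -
  have *: "concat (map \<phi> U) \<approx> concat (map \<phi> V)"
    using assms \<phi>_cong unfolding pcong_def[of A R] by blast
  from cong_invariants[OF this] show deg: "\<kappa> U = \<kappa> V" "length (\<sigma> U) = length (\<sigma> V)"
    by (simp_all add: \<kappa>_def \<sigma>_def)
  show "\<sigma> U = \<sigma> V" if "\<kappa> U = 0"
    using cong_invariants(3)[OF *] that deg by (simp add: \<kappa>_def \<sigma>_def nf_ab)
qed

definition edge_form :: "'s edge \<Rightarrow> int" where
  "edge_form e = form (\<sigma> (esrc e)) (\<sigma> (etgt e))"

definition integral :: "'s edge list \<Rightarrow> int" where
  "integral es = sum_list (map edge_form es)"

lemma integral_simps [simp]: "integral [] = 0" "integral (e # es) = edge_form e + integral es"
  "integral (es @ fs) = integral es + integral fs"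
  by (simp_all add: integral_def)

text \<open>The left context fixes the first letter, so every difference of \<open>starts_a\<close>
  vanishes.\<close>

lemma integral_whisk_left:
  "\<sigma> u \<noteq> [] \<Longrightarrow> integral (map (ewhisk u v) es) = 0"
  by (induction es) (auto simp: edge_form_def form_def starts_a_append)

text \<open>The right context fixes the value of \<open>ends_ab\<close>; it factors out and the
  differences of \<open>starts_a\<close> telescope.\<close>

lemma integral_whisk_right:
  assumes "2 \<le> length (\<sigma> v)" "is_path A R w es w'"
  shows "integral (map (ewhisk u v) es) =
    ends_ab (\<sigma> v) * (starts_a (\<sigma> (u @ w' @ v)) - starts_a (\<sigma> (u @ w @ v)))"
  using assms(2)
proof (induction es arbitrary: w)
  case (Cons e es)
  then have "integral (map (ewhisk u v) es) =
    ends_ab (\<sigma> v) * (starts_a (\<sigma> (u @ w' @ v)) - starts_a (\<sigma> (u @ etgt e @ v)))" by simp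
  moreover have "esrc e = w" using Cons by simp
  ultimately show ?case
    using ends_ab_append[OF assms(1), of "\<sigma> u @ \<sigma> w"]
    by (simp add: edge_form_def form_def algebra_simps)
qed simp

text \<open>In such a context the integral depends on the endpoints only, whatever the two paths
  are. This disposes both of the pairs in a homotopy base and of overlapping rewrites.\<close>

lemma integral_whisk_parallel:
  assumes "\<sigma> u \<noteq> [] \<or> 2 \<le> length (\<sigma> v)" "is_path A R w es w'" "is_path A R w fs w'"
  shows "integral (map (ewhisk u v) es) = integral (map (ewhisk u v) fs)"
  using assms integral_whisk_left integral_whisk_right by auto

text \<open>With a single c, one of the two rewrites does not touch it and leaves the stripped word
  unchanged. Its edges contribute 0, and the other rewrite is measured between the same stripped
  words in either order.\<close>

lemma edge_form_indep:
  assumes "edge_ok A R e" "edge_ok A R f" "\<kappa> (u @ esrc e @ esrc f @ v) = 1"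
  shows "edge_form (ewhisk u (esrc f @ v) e) + edge_form (ewhisk (u @ etgt e) v f) =
    edge_form (ewhisk (u @ esrc e) v f) + edge_form (ewhisk u (etgt f @ v) e)"
proof -
  have "\<kappa> (esrc e) = 0 \<or> \<kappa> (esrc f) = 0" using assms(3) by auto
  then have "\<sigma> (esrc e) = \<sigma> (etgt e) \<or> \<sigma> (esrc f) = \<sigma> (etgt f)"
    using assms(1,2) edge_cong cong_degrees(3) by blast
  then show ?thesis by (auto simp: edge_form_def)
qed

text \<open>Left sides suffice for the maximum, because both sides of a relation have stripped
  images of equal length. The inserted 0 covers an empty set of relations.\<close>

definition relbound :: nat where
  "relbound = Max (insert 0 ((\<lambda>(l, r). length (\<sigma> l)) ` R))"

lemma relbound: "(l, r) \<in> R \<Longrightarrow> length (\<sigma> l) \<le> relbound"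
  unfolding relbound_def using finite_rels by (intro Max_ge) force+

text \<open>Reversing an edge evaluates \<open>ends_ab\<close> at the other endpoint, so
  antisymmetry fails by the product of the changes of \<open>ends_ab\<close> and
  \<open>starts_a\<close>. In a long word a single edge cannot change both.\<close>

lemma edge_form_einv:
  assumes "edge_ok A R e" "length (\<sigma> (esrc e)) \<ge> relbound + 3"
  shows "edge_form (einv e) = - edge_form e"
proof -
  obtain x l r y where e: "e = (x, l, r, y)" by (cases e)
  have "length (\<sigma> l) \<le> relbound"
  proof -
    have "(l, r) \<in> R \<or> (r, l) \<in> R" using assms(1) by (simp add: e edge_ok_def)
    then show ?thesis
      using relbound cong_degrees(2)[OF pcong_rel, of r l] by auto metis
  qed
  \<comment> \<open>At least three stripped letters lie outside the relation; if none is on the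
    left, all are on the right.\<close>
  then have "\<sigma> x \<noteq> [] \<or> 2 \<le> length (\<sigma> y)" using assms(2) by (auto simp: e)
  moreover have "2 \<le> length (\<sigma> y) \<Longrightarrow>
      ends_ab (\<sigma> x @ \<sigma> l @ \<sigma> y) = ends_ab (\<sigma> x @ \<sigma> r @ \<sigma> y)"
    using ends_ab_append[of "\<sigma> y" "\<sigma> x @ \<sigma> l"] ends_ab_append[of "\<sigma> y" "\<sigma> x @ \<sigma> r"] by simp
  ultimately show ?thesis
    by (auto simp: e edge_form_def form_def starts_a_append algebra_simps)
qed

lemma edge_degrees:
  assumes "edge_ok A R e"
  shows "\<kappa> (etgt e) = \<kappa> (esrc e)" "length (\<sigma> (etgt e)) = length (\<sigma> (esrc e))"
  using cong_degrees[OF edge_cong[OF assms]] by simp_all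

lemma integral_inverse:
  assumes "is_path A R w es w'" "length (\<sigma> w) \<ge> relbound + 3"
  shows "integral (rev (map einv es)) = - integral es"
  using assms
proof (induction es arbitrary: w)
  case (Cons e es)
  then have "length (\<sigma> (etgt e)) \<ge> relbound + 3" using edge_degrees by auto
  with Cons show ?case using edge_form_einv by auto
qed simp

definition path_independent :: "nat \<Rightarrow> bool" where
  "path_independent n \<longleftrightarrow> (\<forall>w es fs w'. is_path A R w es w' \<longrightarrow> is_path A R w fs w' \<longrightarrow>
     \<kappa> w = 1 \<longrightarrow> n \<le> length (\<sigma> w) \<longrightarrow> integral es = integral fs)"

lemma not_path_independent: "\<not> path_independent n"
proof
  assume ind: "path_independent n"
  \<comment> \<open>The filler makes the words of the square as long as required.\<close>
  define z where "z = replicate n b"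
  have z: "cdeg z = 0" "strip z = z" "length z = n"
    by (simp_all add: z_def strip_def)
  have "nf [a, c, b] = nf [b, c, b]" by (simp add: nf_def atail_Cons)
  then obtain es where es: "is_path A R (\<Psi> [a, c, b]) es (\<Psi> [b, c, b])"
    using \<Psi>_path cong_iff by blast
  have "nf ([c, b] @ z @ [a, b]) = nf ([c, b] @ z @ [b, b])"
    using z by (simp add: nf_def atail_Cons atail_append)
  then obtain fs where fs: "is_path A R (\<Psi> ([c, b] @ z @ [a, b])) fs (\<Psi> ([c, b] @ z @ [b, b]))"
    using \<Psi>_path cong_iff by blast
  let ?e = "\<lambda>x. map (ewhisk [] (\<Psi> (z @ [x, b]))) es"
  let ?f = "\<lambda>x. map (ewhisk (\<Psi> [x]) []) fs"
  have e: "is_path A R (\<Psi> ([a, c, b] @ z @ [x, b])) (?e x) (\<Psi> ([b, c, b] @ z @ [x, b]))" for x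
    using path_whisk[OF es, OF lists.Nil \<Psi>_in_lists, of "z @ [x, b]"]
    by (simp only: \<Psi>_append append_Nil)
  have cons: "\<Psi> (x # c # b # w) = \<Psi> [x] @ \<Psi> ([c, b] @ w)" for x w
    by (simp add: \<Psi>_def)
  have f: "is_path A R (\<Psi> ([x, c, b] @ z @ [a, b])) (?f x) (\<Psi> ([x, c, b] @ z @ [b, b]))" for x
    using path_whisk[OF fs, of "\<Psi> [x]" "[]"] \<Psi>_in_lists cons
    by (simp del: lists.simps \<Psi>_append)
  have "integral (?e a @ ?f b) = integral (?f a @ ?e b)"
  proof (rule ind[unfolded path_independent_def, rule_format])
    show "is_path A R (\<Psi> ([a, c, b] @ z @ [a, b])) (?e a @ ?f b) (\<Psi> ([b, c, b] @ z @ [b, b]))"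
      by (rule path_append[OF e f])
    show "is_path A R (\<Psi> ([a, c, b] @ z @ [a, b])) (?f a @ ?e b) (\<Psi> ([b, c, b] @ z @ [b, b]))"
      by (rule path_append[OF f e])
  qed (simp_all add: z)
  \<comment> \<open>The rewrites at the far end take place behind the first letter.\<close>
  moreover have "integral (?f a) = 0" "integral (?f b) = 0"
    by (simp_all add: integral_whisk_left)
  \<comment> \<open>Changing the initial a into b contributes -1 while the word still ends in ab,
    that is for \<open>x\<close> equal to a, and 0 once it ends in bb.\<close>
  moreover have "integral (?e x) = - ends_ab (strip z @ [x, b])" if "x \<noteq> c" for x
    using that integral_whisk_right[OF _ es, of "\<Psi> (z @ [x, b])" "[]"]
    by (simp add: starts_a_def)
  ultimately show False
    by (simp add: ends_ab_def)
qed

end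

section \<open>Homotopy bases and path independence\<close>

fun edges :: "'s dpath \<Rightarrow> 's edge list" where
  "edges (w, es, w') = es"

context monM_presentation
begin

lemma valid_path_iff: "valid_path A R P \<longleftrightarrow> is_path A R (psrc P) (edges P) (ptgt P)"
  by (cases P) simp

text \<open>The induction on homotopies below bounds words through the source of the first path;
  symmetry and transitivity pass because homotopic paths share their source.\<close>

lemma homotopy_parallel: "(P, Q) \<in> homotopy A R X \<Longrightarrow> parallel A R P Q"
proof (induction rule: homotopy.induct)
  case (h_whisk P Q u v)
  obtain w es w' and x fs x' where "P = (w, es, w')" "Q = (x, fs, x')" by (metis prod_cases3)
  with h_whisk show ?case by (auto simp: parallel_def intro: path_whisk)
next
  case (h_compL P Q r)
  obtain w es w' and v fs v' and x gs x'
    where "P = (w, es, w')" "Q = (v, fs, v')" "r = (x, gs, x')" by (metis prod_cases3)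
  with h_compL show ?case by (auto simp: parallel_def intro: path_append)
next
  case (h_compR P Q r)
  obtain w es w' and v fs v' and x gs x'
    where "P = (w, es, w')" "Q = (v, fs, v')" "r = (x, gs, x')" by (metis prod_cases3)
  with h_compR show ?case by (auto simp: parallel_def intro: path_append)
next
  case (h_inv P)
  then have p: "is_path A R (psrc P) (edges P) (ptgt P)"
    by (simp add: valid_path_iff)
  have "is_path A R (psrc P) (edges P @ rev (map einv (edges P))) (psrc P)"
    by (rule path_append[OF p path_inverse[OF p]])
  moreover have "psrc P \<in> lists A" using h_inv path_in_lists by (auto simp: valid_path_iff)
  ultimately show ?case by (cases P) (simp add: parallel_def)
next
  case (h_indep e1 e2)
  then have "is_path A R (esrc (ewhisk [] (esrc e2) e1))
      [ewhisk [] (esrc e2) e1, ewhisk (etgt e1) [] e2]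
      (etgt (ewhisk (etgt e1) [] e2))"
    "is_path A R (esrc (ewhisk (esrc e1) [] e2))
      [ewhisk (esrc e1) [] e2, ewhisk [] (etgt e2) e1]
      (etgt (ewhisk [] (etgt e2) e1))"
    using edge_in_lists[OF h_indep(1)] edge_in_lists[OF h_indep(2)]
    by (simp_all add: edge_ok_ewhisk)
  then show ?case by (simp add: parallel_def epath_def)
qed (auto simp: parallel_def)

lemma path_degrees:
  assumes "is_path A R w es w'"
  shows "\<kappa> w' = \<kappa> w" "length (\<sigma> w') = length (\<sigma> w)"
  using cong_degrees[OF path_cong[OF assms]] by simp_all

text \<open>Whiskering a pair of \<open>X\<close> to a long word leaves the beginning or the end of the word untouched;
  the statement is quantified over all contexts so that the induction passes through whiskering.\<close>

lemma homotopy_integral: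
  assumes "(P, Q) \<in> homotopy A R X"
    and X: "\<And>P Q. (P, Q) \<in> X \<Longrightarrow> length (\<sigma> (psrc P)) \<le> m"
    and "u \<in> lists A" "v \<in> lists A"
    and "\<kappa> (u @ psrc P @ v) = 1" "m + relbound + 3 \<le> length (\<sigma> (u @ psrc P @ v))"
  shows "integral (map (ewhisk u v) (edges P)) = integral (map (ewhisk u v) (edges Q))"
  using assms(1,3-)
proof (induction arbitrary: u v rule: homotopy.induct)
  case (h_base P Q)
  have "length (\<sigma> (psrc P)) \<le> m" by (rule X[OF h_base(1)])
  \<comment> \<open>The pair occupies at most \<open>m\<close> stripped letters, so the context has
    at least three.\<close>
  then have "\<sigma> u \<noteq> [] \<or> 2 \<le> length (\<sigma> v)" using h_base.prems(4) by auto
  moreover have "is_path A R (psrc P) (edges P) (ptgt P)" "is_path A R (psrc P) (edges Q) (ptgt P)"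
    using h_base(2) by (auto simp: parallel_def valid_path_iff)
  ultimately show ?case by (rule integral_whisk_parallel)
next
  case (h_sym P Q)
  then have "psrc P = psrc Q" using homotopy_parallel by (auto simp: parallel_def)
  with h_sym show ?case by simp
next
  case (h_trans P Q S)
  then have "psrc P = psrc Q" using homotopy_parallel by (auto simp: parallel_def)
  with h_trans show ?case by simp
next
  case (h_whisk P Q u' v')
  have "edges (pwhisk u' v' S) = map (ewhisk u' v') (edges S)"
    "psrc (pwhisk u' v' S) = u' @ psrc S @ v'"
    for S :: "'s dpath"
    by (cases S; simp)+
  with h_whisk show ?case by (simp add: comp_def del: \<sigma>_append)
next
  case (h_compL P Q r)
  have e: "edges (pcomp r S) = edges r @ edges S" "psrc (pcomp r S) = psrc r" for S
    by (cases r; cases S; simp)+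
  have "is_path A R (psrc r) (edges r) (psrc P)"
    using h_compL by (auto simp: valid_path_iff)
  \<comment> \<open>The degrees are constant along \<open>r\<close>, so the conditions on its source
    hold at the source of \<open>P\<close>.\<close>
  then have "\<kappa> (psrc P) = \<kappa> (psrc r)" "length (\<sigma> (psrc P)) = length (\<sigma> (psrc r))"
    by (auto dest: path_degrees)
  with h_compL show ?case by (simp add: e)
next
  case (h_compR P Q r)
  have "edges (pcomp S r) = edges S @ edges r" "psrc (pcomp S r) = psrc S" for S
    by (cases r; cases S; simp)+
  with h_compR show ?case by simp
next
  case (h_inv P)
  have e: "edges (pcomp P (pinv P)) = edges P @ rev (map einv (edges P))"
    "psrc (pcomp P (pinv P)) = psrc P"
    by (cases P; simp)+
  have "is_path A R (u @ psrc P @ v) (map (ewhisk u v) (edges P)) (u @ ptgt P @ v)"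
    using h_inv path_whisk by (auto simp: valid_path_iff)
  then have "integral (rev (map einv (map (ewhisk u v) (edges P)))) =
      - integral (map (ewhisk u v) (edges P))"
    by (rule integral_inverse) (use h_inv e in simp)
  moreover have "rev (map einv (map (ewhisk u v) (edges P))) =
      map (ewhisk u v) (rev (map einv (edges P)))"
    by (simp add: rev_map ewhisk_einv)
  ultimately show ?case by (simp add: e)
next
  case (h_indep e1 e2)
  then show ?case
    using edge_form_indep[OF h_indep(1,2), of u v] by (simp add: epath_def)
qed auto

lemma finite_base_imp_path_independent:
  assumes "finite X" "homotopy_base A R X"
  shows "\<exists>n. path_independent n"
proof -
  define m where "m = Max (insert 0 ((\<lambda>(P, Q). length (\<sigma> (psrc P))) ` X))"
  have X: "length (\<sigma> (psrc P)) \<le> m" if "(P, Q) \<in> X" for P Q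
    unfolding m_def using assms(1)
    by (intro Max_ge insertI2 image_eqI[OF _ that]) simp_all
  have "path_independent (m + relbound + 3)"
    unfolding path_independent_def
  proof (intro allI impI)
    fix w es fs w'
    assume "is_path A R w es w'" "is_path A R w fs w'"
      and w: "\<kappa> w = 1" "m + relbound + 3 \<le> length (\<sigma> w)"
    then have "((w, es, w'), (w, fs, w')) \<in> homotopy A R X"
      using assms(2) by (simp add: homotopy_base_def parallel_def)
    then have "integral (map (ewhisk [] []) (edges (w, es, w'))) =
        integral (map (ewhisk [] []) (edges (w, fs, w')))"
      by (rule homotopy_integral[where m = m]) (use X w in simp_all)
    then show "integral es = integral fs" by (simp add: map_idI)
  qed
  then show ?thesis ..
qed

section \<open>Finite complete systems\<close>

text \<open>For a complete system the form has a potential: its integral along a reduction to normal form.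
  Overlapping rewrites happen inside a bounded window, and disjoint ones commute with equal
  integrals, so Newman's argument shows that the choice of the reduction does not matter.\<close>

definition forward :: "'s edge list \<Rightarrow> bool" where
  "forward es \<longleftrightarrow> (\<forall>(x, l, r, y) \<in> set es. (l, r) \<in> R)"

lemma forward_simps [simp]: "forward []"
  "forward ((x, l, r, y) # es) \<longleftrightarrow> (l, r) \<in> R \<and> forward es"
  "forward (es @ fs) \<longleftrightarrow> forward es \<and> forward fs"
  "forward (map (ewhisk u v) es) \<longleftrightarrow> forward es"
  by (force simp: forward_def)+

text \<open>The relation \<open>rew\<close> forgets where a rule was applied; integration needs the
  edges.\<close>

lemma rew_forward_path:
  assumes "(rew A R)\<^sup>*\<^sup>* u v" "u \<in> lists A"
  shows "\<exists>es. is_path A R u es v \<and> forward es"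
  using assms
proof (induction rule: rtranclp_induct)
  case base
  then show ?case by (intro exI[of _ "[]"]) simp
next
  case (step v w)
  then obtain es where es: "is_path A R u es v" "forward es" by blast
  obtain x y l r where v: "v \<in> lists A" "(l, r) \<in> R" "v = x @ l @ y" "w = x @ r @ y"
    using step(2) unfolding rew_def rstep_def by blast
  then have "is_path A R v [(x, l, r, y)] w"
    using rels by (auto simp: edge_ok_def)
  with es v show ?case
    using path_append[OF es(1)] by (intro exI[of _ "es @ [(x, l, r, y)]"]) simp
qed

lemma forward_path_rew: "is_path A R u es v \<Longrightarrow> forward es \<Longrightarrow> (rew A R)\<^sup>*\<^sup>* u v"
proof (induction es arbitrary: u)
  case (Cons e es)
  obtain x l r y where e: "e = (x, l, r, y)" by (cases e)
  have "rew A R u (etgt e)"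
    using Cons.prems edge_in_lists[of e] by (auto simp: e rew_def rstep_def)
  moreover have "(rew A R)\<^sup>*\<^sup>* (etgt e) v" using Cons by (simp add: e)
  ultimately show ?case by (rule converse_rtranclp_into_rtranclp)
qed simp

text \<open>Confluence is used for the word \<open>w\<close> of the window alone. The resulting
  diamond is then placed into the context, where its two sides are parallel paths with equal
  integrals.\<close>

lemma peak_in_window:
  assumes complete: "complete_rs A R"
    and "is_path A R w [e] w1" "is_path A R w [f] w2" "forward [e]" "forward [f]"
    and "u \<in> lists A" "v \<in> lists A" "\<sigma> u \<noteq> [] \<or> 2 \<le> length (\<sigma> v)"
  shows "\<exists>z es fs. is_path A R (u @ w1 @ v) es z \<and> forward es \<and>
    is_path A R (u @ w2 @ v) fs z \<and> forward fs \<and>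
    edge_form (ewhisk u v e) + integral es = edge_form (ewhisk u v f) + integral fs"
proof -
  have lists: "w1 \<in> lists A" "w2 \<in> lists A" using assms(2,3) path_in_lists by blast+
  have "(rew A R)\<^sup>*\<^sup>* w w1" "(rew A R)\<^sup>*\<^sup>* w w2"
    using assms forward_path_rew by blast+
  then obtain z where "(rew A R)\<^sup>*\<^sup>* w1 z" "(rew A R)\<^sup>*\<^sup>* w2 z"
    using complete unfolding complete_rs_def by blast
  then obtain es fs where es: "is_path A R w1 es z" "forward es"
    and fs: "is_path A R w2 fs z" "forward fs"
    using lists rew_forward_path by meson
  have "is_path A R w ([e] @ es) z" "is_path A R w ([f] @ fs) z"
    using es fs assms path_append by blast+
  from integral_whisk_parallel[OF assms(8) this]
  have "edge_form (ewhisk u v e) + integral (map (ewhisk u v) es) =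
      edge_form (ewhisk u v f) + integral (map (ewhisk u v) fs)" by simp
  moreover have "is_path A R (u @ w1 @ v) (map (ewhisk u v) es) (u @ z @ v)"
    "is_path A R (u @ w2 @ v) (map (ewhisk u v) fs) (u @ z @ v)"
    using es fs assms path_whisk by blast+
  ultimately show ?thesis
    using es(2) fs(2) by (intro exI[of _ "u @ z @ v"] exI[of _ "map (ewhisk u v) es"]
        exI[of _ "map (ewhisk u v) fs"]) simp
qed

text \<open>The usual analysis of two redexes: disjoint, properly overlapping, or one inside the
  other. Overlapping left sides span a window of at most \<open>2 * relbound\<close> stripped
  letters, which leaves three for the context.\<close>

lemma peak_ordered:
  assumes complete: "complete_rs A R"
    and R: "(l1, r1) \<in> R" "(l2, r2) \<in> R"
    and lists: "x1 \<in> lists A" "y1 \<in> lists A" "x2 \<in> lists A" "y2 \<in> lists A"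
    and eq: "x1 @ l1 @ y1 = x2 @ l2 @ y2" and le: "length x1 \<le> length x2"
    and big: "\<kappa> (x1 @ l1 @ y1) = 1" "2 * relbound + 3 \<le> length (\<sigma> (x1 @ l1 @ y1))"
  shows "\<exists>z es fs. is_path A R (x1 @ r1 @ y1) es z \<and> forward es \<and>
    is_path A R (x2 @ r2 @ y2) fs z \<and> forward fs \<and>
    edge_form (x1, l1, r1, y1) + integral es = edge_form (x2, l2, r2, y2) + integral fs"
proof -
  note bounds = relbound[OF R(1)] relbound[OF R(2)]
  have in_lists: "l1 \<in> lists A" "r1 \<in> lists A" "l2 \<in> lists A" "r2 \<in> lists A"
    using R rels by auto
  obtain s where s: "x2 = x1 @ s" "l1 @ y1 = s @ l2 @ y2"
  proof -
    obtain s where "x1 = x2 @ s \<and> s @ l1 @ y1 = l2 @ y2 \<or> x1 @ s = x2 \<and> l1 @ y1 = s @ l2 @ y2"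
      using iffD1[OF append_eq_append_conv2 eq] by blast
    then have "x2 = x1 @ s" "l1 @ y1 = s @ l2 @ y2" using le by auto
    then show thesis by (rule that)
  qed
  consider (disjoint) t where "s = l1 @ t" "y1 = t @ l2 @ y2"
    | (overlap) s' where "l1 = s @ s'" "s' @ y1 = l2 @ y2"
    using iffD1[OF append_eq_append_conv2 s(2)] by metis
  then show ?thesis
  proof cases
    case disjoint
    \<comment> \<open>The gap \<open>t\<close> between the redexes is assigned to the first edge, so
      that the two edges become adjacent.\<close>
    let ?e = "([], l1, r1, t)" and ?f = "([], l2, r2, [])"
    have t: "t \<in> lists A" using lists disjoint by auto
    have "edge_ok A R ?e" "edge_ok A R ?f" using R t by (auto simp: edge_ok_def)
    from edge_form_indep[OF this, of x1 y2]
    have "edge_form (x1, l1, r1, y1) + edge_form (x1 @ r1 @ t, l2, r2, y2) =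
        edge_form (x2, l2, r2, y2) + edge_form (x1, l1, r1, t @ r2 @ y2)"
      using big by (simp add: disjoint s)
    moreover have "is_path A R (x1 @ r1 @ y1) [(x1 @ r1 @ t, l2, r2, y2)] (x1 @ r1 @ t @ r2 @ y2)"
      "is_path A R (x2 @ r2 @ y2) [(x1, l1, r1, t @ r2 @ y2)] (x1 @ r1 @ t @ r2 @ y2)"
      using lists R t in_lists by (auto simp: edge_ok_def disjoint s)
    ultimately show ?thesis
      using R by (intro exI[of _ "x1 @ r1 @ t @ r2 @ y2"] exI[of _ "[(x1 @ r1 @ t, l2, r2, y2)]"]
          exI[of _ "[(x1, l1, r1, t @ r2 @ y2)]"]) simp
  next
    case overlap
    have slists: "s \<in> lists A" "s' \<in> lists A" using in_lists overlap by auto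
    consider (left) t where "l2 = s' @ t" "y1 = t @ y2" | (inside) t where "s' = l2 @ t" "y2 = t @ y1"
      using iffD1[OF append_eq_append_conv2 overlap(2)] by metis
    then show ?thesis
    proof cases
      case left
      have t: "t \<in> lists A" using in_lists left by auto
      have "is_path A R (l1 @ t) [([], l1, r1, t)] (r1 @ t)"
        "is_path A R (l1 @ t) [(s, l2, r2, [])] (s @ r2)"
        using R t slists in_lists by (auto simp: edge_ok_def overlap left)
      moreover have "\<sigma> x1 \<noteq> [] \<or> 2 \<le> length (\<sigma> y2)"
        using big bounds by (auto simp: left)
      ultimately show ?thesis
        using peak_in_window[OF complete, of "l1 @ t" "([], l1, r1, t)" "r1 @ t" "(s, l2, r2, [])"
            "s @ r2" x1 y2] R lists by (simp add: s left)
    next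
      case inside
      have t: "t \<in> lists A" using slists inside by auto
      have "is_path A R l1 [([], l1, r1, [])] r1"
        "is_path A R l1 [(s, l2, r2, t)] (s @ r2 @ t)"
        using R t slists in_lists by (auto simp: edge_ok_def overlap inside)
      moreover have "\<sigma> x1 \<noteq> [] \<or> 2 \<le> length (\<sigma> y1)"
        using big bounds by auto
      ultimately show ?thesis
        using peak_in_window[OF complete, of l1 "([], l1, r1, [])" r1 "(s, l2, r2, t)"
            "s @ r2 @ t" x1 y1] R lists by (simp add: s inside)
    qed
  qed
qed

lemma peak:
  assumes complete: "complete_rs A R"
    and e: "edge_ok A R e" "forward [e]" "esrc e = w" and f: "edge_ok A R f" "forward [f]" "esrc f = w"
    and big: "\<kappa> w = 1" "2 * relbound + 3 \<le> length (\<sigma> w)"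
  shows "\<exists>z es fs. is_path A R (etgt e) es z \<and> forward es \<and> is_path A R (etgt f) fs z \<and> forward fs \<and>
    edge_form e + integral es = edge_form f + integral fs"
proof -
  obtain x1 l1 r1 y1 where e': "e = (x1, l1, r1, y1)" by (cases e)
  obtain x2 l2 r2 y2 where f': "f = (x2, l2, r2, y2)" by (cases f)
  have lists: "x1 \<in> lists A" "y1 \<in> lists A" "x2 \<in> lists A" "y2 \<in> lists A"
    using e f by (auto simp: e' f' edge_ok_def)
  have R: "(l1, r1) \<in> R" "(l2, r2) \<in> R" using e f by (auto simp: e' f')
  have w: "x1 @ l1 @ y1 = w" "x2 @ l2 @ y2 = w" using e f by (auto simp: e' f')
  show ?thesis
  proof (cases "length x1 \<le> length x2")
    case True
    then have "\<exists>z es fs. is_path A R (x1 @ r1 @ y1) es z \<and> forward es \<and>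
      is_path A R (x2 @ r2 @ y2) fs z \<and> forward fs \<and>
      edge_form (x1, l1, r1, y1) + integral es = edge_form (x2, l2, r2, y2) + integral fs"
      by (intro peak_ordered[OF complete R lists]) (simp_all only: w big)
    then show ?thesis unfolding e' f' etgt.simps .
  next
    case False
    then have "\<exists>z es fs. is_path A R (x2 @ r2 @ y2) es z \<and> forward es \<and>
      is_path A R (x1 @ r1 @ y1) fs z \<and> forward fs \<and>
      edge_form (x2, l2, r2, y2) + integral es = edge_form (x1, l1, r1, y1) + integral fs"
      by (intro peak_ordered[OF complete R(2,1)]) (simp_all only: w big lists, simp?)
    then show ?thesis unfolding e' f' etgt.simps by metis
  qed
qed

definition irreducible_word :: "'s list \<Rightarrow> bool" where
  "irreducible_word w \<longleftrightarrow> (\<forall>v. \<not> rew A R w v)"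

lemma normalizing_path:
  assumes "complete_rs A R" "w \<in> lists A"
  shows "\<exists>es z. is_path A R w es z \<and> forward es \<and> irreducible_word z"
proof -
  have "wf {(v, u). rew A R u v}" using assms(1) by (simp add: complete_rs_def)
  then have "\<exists>z. (rew A R)\<^sup>*\<^sup>* w z \<and> irreducible_word z"
  proof (induction w rule: wf_induct_rule)
    case (less w)
    show ?case
    proof (cases "irreducible_word w")
      case False
      then obtain v where v: "rew A R w v" by (auto simp: irreducible_word_def)
      with less obtain z where "(rew A R)\<^sup>*\<^sup>* v z" "irreducible_word z" by blast
      with v show ?thesis by (meson converse_rtranclp_into_rtranclp)
    qed auto
  qed
  then show ?thesis using rew_forward_path assms(2) by blast
qed

lemma irreducible_path: "irreducible_word w \<Longrightarrow> is_path A R w es z \<Longrightarrow> forward es \<Longrightarrow> es = []"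
proof (rule ccontr)
  assume irr: "irreducible_word w" and p: "is_path A R w es z" "forward es" "es \<noteq> []"
  then obtain e fs where es: "es = e # fs" by (cases es) auto
  obtain x l r y where e: "e = (x, l, r, y)" by (cases e)
  have "rew A R w (etgt e)"
    using p edge_in_lists[of e] by (auto simp: es e rew_def rstep_def)
  with irr show False by (simp add: irreducible_word_def)
qed

lemma normalizing_integral:
  assumes complete: "complete_rs A R"
    and "is_path A R w es z" "forward es" "irreducible_word z"
    and "is_path A R w fs z'" "forward fs" "irreducible_word z'"
    and "\<kappa> w = 1" "2 * relbound + 3 \<le> length (\<sigma> w)"
  shows "integral es = integral fs"
proof -
  have "wf {(v, u). rew A R u v}" using complete by (simp add: complete_rs_def)
  then show ?thesis
    using assms(2-)
  proof (induction w arbitrary: es fs z z' rule: wf_induct_rule)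
    case (less w)
    show ?case
    proof (cases "irreducible_word w")
      case True
      then show ?thesis using less irreducible_path by blast
    next
      case False
      then have "es \<noteq> []" "fs \<noteq> []" using less.prems by auto
      then obtain e es' f fs' where es: "es = e # es'" and fs: "fs = f # fs'"
        by (meson neq_Nil_conv)
      have e: "edge_ok A R e" "forward [e]" "esrc e = w" "is_path A R (etgt e) es' z" "forward es'"
        and f: "edge_ok A R f" "forward [f]" "esrc f = w" "is_path A R (etgt f) fs' z'" "forward fs'"
        using less.prems by (auto simp: es fs forward_def)
      obtain y g h where g: "is_path A R (etgt e) g y" "forward g"
        and h: "is_path A R (etgt f) h y" "forward h"
        and eq: "edge_form e + integral g = edge_form f + integral h"
        using peak[OF complete e(1-3) f(1-3)] less.prems by blast
      \<comment> \<open>Reducing the common word further turns both sides of the diamond into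
        complete reductions, to which the induction hypothesis compares \<open>es'\<close> and
        \<open>fs'\<close>.\<close>
      obtain k x where k: "is_path A R y k x" "forward k" "irreducible_word x"
        using normalizing_path[OF complete] path_in_lists[OF g(1)] by blast
      have rew: "rew A R w (etgt e)" if "edge_ok A R e" "forward [e]" "esrc e = w" for e
        using that edge_in_lists[of e] by (cases e) (auto simp: rew_def rstep_def)
      have "integral es' = integral (g @ k)"
        using less.IH[OF _ e(4,5) less.prems(3), of "g @ k" x] rew[OF e(1-3)] g k less.prems
          edge_degrees[OF e(1)] path_append[OF g(1) k(1)] e(3) by simp
      moreover have "integral fs' = integral (h @ k)"
        using less.IH[OF _ f(4,5) less.prems(6), of "h @ k" x] rew[OF f(1-3)] h k less.prems
          edge_degrees[OF f(1)] path_append[OF h(1) k(1)] f(3) by simp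
      ultimately show ?thesis using eq by (simp add: es fs)
    qed
  qed
qed

lemma complete_imp_path_independent:
  assumes complete: "complete_rs A R"
  shows "path_independent (2 * relbound + 3)"
proof -
  \<comment> \<open>The choice is harmless: by \<open>normalizing_integral\<close> all complete
    reductions of a long word with one c have the same integral.\<close>
  define pot where "pot w = (SOME i. \<exists>es z. is_path A R w es z \<and> forward es \<and> irreducible_word z \<and>
    i = integral es)" for w
  have pot: "pot w = integral es"
    if w: "\<kappa> w = 1" "2 * relbound + 3 \<le> length (\<sigma> w)"
      and es: "is_path A R w es z" "forward es" "irreducible_word z" for w es z
    unfolding pot_def
    by (rule some_equality) (use es normalizing_integral[OF complete _ _ _ _ _ _ w] in blast)+
  have fwd: "edge_form e = pot (esrc e) - pot (etgt e)"
    if e: "edge_ok A R e" "forward [e]" "\<kappa> (esrc e) = 1" "2 * relbound + 3 \<le> length (\<sigma> (esrc e))" for e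
  proof -
    obtain es z where es: "is_path A R (etgt e) es z" "forward es" "irreducible_word z"
      using normalizing_path[OF complete] edge_in_lists[OF e(1)] by blast
    then have "pot (etgt e) = integral es"
      by (intro pot) (use edge_degrees[OF e(1)] e in auto)
    moreover have "pot (esrc e) = integral (e # es)"
      by (rule pot) (use es e in \<open>auto simp: forward_def\<close>)
    ultimately show ?thesis by simp
  qed
  have edge: "edge_form e = pot (esrc e) - pot (etgt e)"
    if e: "edge_ok A R e" "\<kappa> (esrc e) = 1" "2 * relbound + 3 \<le> length (\<sigma> (esrc e))" for e
  proof (cases "forward [e]")
    case False
    \<comment> \<open>An edge against the direction of the rules is the inverse of a forward one;
      antisymmetry of the form in long words transfers the potential.\<close>
    then have "forward [einv e]" using e by (cases e) (auto simp: edge_ok_def)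
    then have "edge_form (einv e) = pot (etgt e) - pot (esrc e)"
      using fwd[of "einv e"] e edge_degrees[OF e(1)] by (simp add: edge_ok_einv)
    moreover have "edge_form (einv e) = - edge_form e" using e by (intro edge_form_einv) auto
    ultimately show ?thesis by simp
  qed (use e fwd in blast)
  have "integral es = pot w - pot w'"
    if "is_path A R w es w'" "\<kappa> w = 1" "2 * relbound + 3 \<le> length (\<sigma> w)" for w es w'
    using that
  proof (induction es arbitrary: w)
    case (Cons e es)
    then have "integral es = pot (etgt e) - pot w'" using edge_degrees[of e] by auto
    moreover have "edge_form e = pot w - pot (etgt e)" using edge Cons.prems by auto
    ultimately show ?case by simp
  qed simp
  then show ?thesis unfolding path_independent_def by metis
qed

end

section \<open>From an isomorphism to representatives of the generators\<close>

lemma monM_presentationI: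
  assumes iso: "pres_monoid A R \<cong> monM" and R: "finite R" "R \<subseteq> lists A \<times> lists A"
  shows "\<exists>\<phi> \<psi>. monM_presentation A R \<phi> \<psi>"
proof -
  interpret presentation A R by unfold_locales (rule R(2))
  obtain h where h: "h \<in> hom (pres_monoid A R) monM"
    "bij_betw h (carrier (pres_monoid A R)) (carrier monM)"
    using iso by (auto simp: is_iso_def iso_def)
  have surj: "\<exists>U\<in>lists A. h (pclass A R U) = pclass UNIV relsM w" for w
  proof -
    have "pclass UNIV relsM w \<in> h ` carrier (pres_monoid A R)"
      using h(2) M.pclass_in_carrier[of w] by (simp add: bij_betw_def monM_def)
    then show ?thesis by (auto simp: carrier_pres_monoid)
  qed
  have inj: "h (pclass A R U) = h (pclass A R V) \<longleftrightarrow> pcong A R U V"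
    if "U \<in> lists A" "V \<in> lists A" for U V
    using that inj_on_eq_iff[OF bij_betw_imp_inj_on[OF h(2)]]
    by (simp add: pclass_in_carrier pclass_eq_iff)
  have mult: "h (pclass A R (U @ V)) = h (pclass A R U) \<otimes>\<^bsub>monM\<^esub> h (pclass A R V)"
    if "U \<in> lists A" "V \<in> lists A" for U V
    using hom_mult[OF h(1)] that by (simp add: pclass_in_carrier flip: pclass_mult)
  have ex: "\<exists>w. h (pclass A R U) = pclass UNIV relsM w" if "U \<in> lists A" for U
  proof -
    have "h (pclass A R U) \<in> carrier monM"
      using h(1) pclass_in_carrier[OF that] by (auto simp: hom_def)
    then show ?thesis by (auto simp: monM_def M.carrier_pres_monoid)
  qed
  define \<phi> where "\<phi> x = (SOME w. h (pclass A R [x]) = pclass UNIV relsM w)" for x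
  have \<phi>: "h (pclass A R [x]) = pclass UNIV relsM (\<phi> x)" if "x \<in> A" for x
    unfolding \<phi>_def by (rule someI_ex) (use ex that in simp)
  \<comment> \<open>Membership in \<open>hom\<close> gives multiplicativity only. Surjectivity
    provides a preimage of the identity, and multiplying it by the empty word shows that the class
    of the empty word is sent to the identity.\<close>
  have one: "h (pclass A R []) = pclass UNIV relsM []"
  proof -
    obtain e where e: "h (pclass A R []) = pclass UNIV relsM e" using ex[of "[]"] by auto
    obtain U where U: "U \<in> lists A" "h (pclass A R U) = pclass UNIV relsM []" using surj by blast
    have "pclass UNIV relsM e \<otimes>\<^bsub>monM\<^esub> pclass UNIV relsM [] = pclass UNIV relsM []"
      using mult[of "[]" U] U e by simp
    then show ?thesis using e by (simp add: monM_def M.pclass_mult)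
  qed
  have h_\<phi>: "h (pclass A R U) = pclass UNIV relsM (concat (map \<phi> U))" if "U \<in> lists A" for U
    using that
  proof (induction U)
    case (Cons x U)
    then show ?case
      using mult[of "[x]" U] \<phi>[of x] by (simp add: monM_def M.pclass_mult)
  qed (simp add: one)
  define \<psi> where "\<psi> g = (SOME U. U \<in> lists A \<and> h (pclass A R U) = pclass UNIV relsM [g])" for g
  have \<psi>: "\<psi> g \<in> lists A" "h (pclass A R (\<psi> g)) = pclass UNIV relsM [g]" for g
    using someI_ex[of "\<lambda>U. U \<in> lists A \<and> h (pclass A R U) = pclass UNIV relsM [g]"] surj[of "[g]"]
    unfolding \<psi>_def by blast+
  \<comment> \<open>This upgrades the congruence between \<open>[g]\<close> and the image of
    \<open>\<psi> g\<close> to the equality demanded by the locale.\<close>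
  have singleton: "w = [g]" if "w \<approx> [g]" for w g
  proof -
    have d: "cdeg w = cdeg [g]" "length (strip w) = length (strip [g])"
      and n: "nf w = nf [g]"
      using cong_invariants[OF that] by auto
    show ?thesis
    proof (cases "g = c")
      case True
      then have "length w = 1" using d length_cdeg_strip[of w] by simp
      then obtain x where "w = [x]" by (auto simp: length_Suc_conv)
      with d True show ?thesis by (auto split: if_splits)
    next
      case False
      then show ?thesis using d n nf_ab[of w] nf_ab[of "[g]"] by simp
    qed
  qed
  have "monM_presentation A R \<phi> \<psi>"
  proof
    show "finite R" by (rule R(1))
    show "pcong A R U V \<longleftrightarrow> concat (map \<phi> U) \<approx> concat (map \<phi> V)"
      if "U \<in> lists A" "V \<in> lists A" for U V
      using inj[OF that] h_\<phi> that by (simp add: M.pclass_eq_iff)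
    show "\<psi> g \<in> lists A" for g by (rule \<psi>)
    show "concat (map \<phi> (\<psi> g)) = [g]" for g
      using singleton[OF M.pcong_sym] h_\<phi>[OF \<psi>(1)] \<psi>(2) by (simp add: M.pclass_eq_iff)
  qed
  then show ?thesis by blast
qed

lemma not_FDT_monM: "\<not> FDT monM"
proof
  assume "FDT monM"
  then obtain A :: "nat set" and R X where R: "finite R" "R \<subseteq> lists A \<times> lists A"
    "pres_monoid A R \<cong> monM"
    and X: "finite X" "homotopy_base A R X"
    unfolding FDT_def by blast
  then obtain \<phi> \<psi> where "monM_presentation A R \<phi> \<psi>" using monM_presentationI by blast
  then interpret monM_presentation A R \<phi> \<psi> .
  show False
    using finite_base_imp_path_independent[OF X] not_path_independent by blast
qed

lemma not_FCRS_monM: "\<not> FCRS monM"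
proof
  assume "FCRS monM"
  then obtain A :: "nat set" and R where R: "finite R" "R \<subseteq> lists A \<times> lists A"
    "pres_monoid A R \<cong> monM"
    and complete: "complete_rs A R"
    unfolding FCRS_def by blast
  then obtain \<phi> \<psi> where "monM_presentation A R \<phi> \<psi>" using monM_presentationI by blast
  then interpret monM_presentation A R \<phi> \<psi> .
  show False
    using complete_imp_path_independent[OF complete] not_path_independent by blast
qed

theorem theorem3p8:
  shows "(\<forall>m\<in>carrier monM. \<exists>!u. u \<in> NF \<and> pclass UNIV relsM u = m)
       \<and> biautomatic monM \<and> automatic monM
       \<and> \<not> FDT monM \<and> \<not> FCRS monM"
  using unique_normal_form biautomatic_monM biautomatic_imp_automatic not_FDT_monM not_FCRS_monM
  by blast

end
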